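(* Consider the fixed-sample model with count vector $\mathbf N$, $\|\mathbf N\|_1=N$. Consider any offline dataset $D(\mathbf N)$ with $N(a^* )\ge N_*$ and any unlearning request $U$ with $|U|=k$ consisting of data points of arm $a_0$. Suppose $k\le N(a_0)-\sqrt{\frac{N(a_0)\ln (m/\tau)}{2}}$, and set $\tau=\frac1N$. Let $\gamma=\sqrt{2\ln(1.25/\delta)}/\varepsilon$ and $\gamma_0=\frac43\sqrt{\frac{\pi\ln(Nm)}{N(a_0)-k}}$. Then the arm $\hat a'$ returned by the single-source unlearning algorithm (described in the context) has worst-case expected sub-optimality $\mathbb E[\mu(a^* )-\mu(\hat a')]$, and hence gives $SubOpt(\mathbf N,N_*,k,\varepsilon,\delta)$, bounded as follows. If $\gamma<\gamma_0$, $$SubOpt(\mathbf N,N_*,k,\varepsilon,\delta)=O\left(\max\left\{\sqrt{\frac{\ln(Nm)}{N(a_0)}}+\frac{k\gamma}{N(a_0)},\ \sqrt{\frac{\ln(Nm)}{N_*}}\right\}\right),$$ and if $\gamma\ge\gamma_0$, $$SubOpt(\mathbf N,N_*,k,\varepsilon,\delta)=O\left(\max\left\{\sqrt{\frac{\ln(Nm)}{N(a_0)-k}},\ \sqrt{\frac{\ln(Nm)}{N_*}}\right\}\right),$$ where $O(\cdot)$ hides an absolute constant.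
   Context: Offline stochastic multi-armed bandit: $\mathcal A=[m]$ ($m\ge2$) is the set of arms; pulling arm $a$ gives a reward in $[0,1]$ drawn from a fixed unknown distribution $R(a)$ with mean $\mu(a)$; $a^*=\arg\max_a\mu(a)$. A dataset is $D=\{(a_i,r_i)\}_{i=1}^N$ with independent $r_i\sim R(a_i)$, and $N(a)$ is the number of samples of arm $a$ in $D$. Fixed-sample model: the count vector $\mathbf N=(N(a))_{a\in\mathcal A}\in\mathbb N^m$ is fixed in advance, so the only randomness in $D(\mathbf N)$ is in the rewards; it is required that $N(a^* )\ge N_*$ for a constant $N_*$. A learning algorithm $\pi$ maps datasets to arms. An unlearning algorithm $\pi'$ maps (request, learned arm, stored statistic) to an arm $\hat a'$. The pair is $(\varepsilon,\delta)$-unlearning (UL) if for all $D$, all $U\subseteq D$ and all $A\subseteq\mathcal A$: $\Pr[\pi'(U,\pi(D),T(D))\in A]\le e^\varepsilon\Pr[\pi'(\emptyset,\pi(D\setminus U),T(D\setminus U))\in A]+\delta$ and the same with the two probabilities interchanged; $\emptyset$ here is a fictitious request and $T(D\setminus U)$ may also store information about the actual request. Requests $U$ are selected independently of the rewards of the data points, so that empirical means on $D\setminus U$ are unbiased. Define $$SubOpt(\mathbf N,N_*,k,\varepsilon,\delta)=\inf_{(\pi',\pi)\ (\varepsilon,\delta)\text{-UL}}\ \sup_{D(\mathbf N),\,U\subseteq D}\mathbb E[\mu(a^* )-\mu(\hat a')],$$ with $|U|=k$ and $U$ from $a_0$, the supremum being over reward distributions with $N(a^* )\ge N_*$ and over requests,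 and the expectation over the generation of $D$ and the randomness of $\pi,\pi'$. LCB learner $\pi$ with confidence level $\tau$: for arm $a$ with $N(a)>0$ let $\hat\mu(a)$ be the empirical mean and $b(a)=\sqrt{\ln(m/\tau)/(2N(a))}$; if $N(a)=0$ let $\hat\mu(a)=0$, $b(a)=1$. Put $f_{(a)}(D)=\hat\mu(a)-b(a)$ and $\pi(D)=\hat a=\arg\max_a f_{(a)}(D)$. Single-source unlearning algorithm (applied to the LCB learner's output): let $\gamma_0=\frac43\sqrt{\frac{\pi\ln(m/\tau)}{N(a_0)-k}}$ (here $\pi$ is the number). Start from $F=f(D)$. If $\hat a=a_0$ and $\gamma<\gamma_0$: sample $\nu\sim\mathcal N(0,\sigma^2)$, $\sigma=\frac{3k}{2N(a_0)}\gamma$, and replace $F_{(a_0)}$ by $F_{(a_0)}+\nu$. Otherwise (rollback): replace $F_{(a_0)}$ by $\hat\mu'(a_0)-b'(a_0)$, where $\hat\mu'(a_0)=\frac{\hat\mu(a_0)N(a_0)-\sum_{(a_0,r_i)\in U}r_i}{N(a_0)-k}$ and $b'(a_0)=\sqrt{\frac{\ln(m/\tau)}{2(N(a_0)-k)}}$. Output $\hat a'=\arg\max_aF_{(a)}$. On the reference input $\emptyset$, $T(D\setminus U)$ stores $f(D\setminus U)$, $\pi(D)$, $a_0$, $k$, $N(a_0)$; the algorithm adds to $f_{(a_0)}(D\setminus U)$ noise from the same $\mathcal N(0,\sigma^2)$ exactly when $\pi(D)=a_0$ and $\gamma<\gamma_0$, and outputs the argmax. *)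

theory Defs
  imports "HOL-Probability.Probability"
begin

text \<open>
  Arms are the numbers \<open>0, \<dots>, m - 1\<close>. A dataset is a list of (arm, reward) pairs; a data point
  is a position in this list, so a request \<open>U \<subseteq> D\<close> is a set \<open>U\<close> of positions. The unlearning
  algorithm receives the data points \<open>nths D U\<close> themselves; \<open>nths D (- U)\<close> is \<open>D \<setminus> U\<close>.
\<close>

type_synonym dataset = "(nat \<times> real) list"

definition dataset :: "nat \<Rightarrow> dataset \<Rightarrow> bool" where
  "dataset m D \<longleftrightarrow> set D \<subseteq> {..<m} \<times> {0..1}"

definition num :: "dataset \<Rightarrow> nat \<Rightarrow> nat" where
  "num D a = count_list (map fst D) a"

definition reward_sum :: "dataset \<Rightarrow> nat \<Rightarrow> real" where
  "reward_sum D a = (\<Sum>(a', r) \<leftarrow> D. if a' = a then r else 0)"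

section \<open>Bandit instances and the fixed-sample model\<close>

definition bandit :: "nat \<Rightarrow> (nat \<Rightarrow> real measure) \<Rightarrow> bool" where
  "bandit m R \<longleftrightarrow>
     (\<forall>a<m. prob_space (R a) \<and> sets (R a) = sets borel \<and> (AE x in R a. x \<in> {0..1}))"

definition mu :: "(nat \<Rightarrow> real measure) \<Rightarrow> nat \<Rightarrow> real" where
  "mu R a = (\<integral>x. x \<partial>R a)"

definition optimal_arm :: "nat \<Rightarrow> (nat \<Rightarrow> real measure) \<Rightarrow> nat \<Rightarrow> bool" where
  "optimal_arm m R a \<longleftrightarrow> is_arg_max (mu R) (\<lambda>a. a \<in> {..<m}) a"

text \<open>
  The arms \<open>acts\<close> of the data points are fixed in advance; only the rewards \<open>r\<close> are random, with
  independent \<open>r i \<sim> R (acts ! i)\<close>.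
\<close>

definition data :: "nat list \<Rightarrow> (nat \<Rightarrow> real) \<Rightarrow> dataset" where
  "data acts r = map (\<lambda>i. (acts ! i, r i)) [0..<length acts]"

definition rewards :: "(nat \<Rightarrow> real measure) \<Rightarrow> nat list \<Rightarrow> (nat \<Rightarrow> real) measure" where
  "rewards R acts = (\<Pi>\<^sub>M i\<in>{..<length acts}. R (acts ! i))"

text \<open>
  All reward distributions, orderings of the data points and requests allowed for the count vector
  \<open>N\<close>. The request is a set of positions chosen without looking at the rewards. If the optimal arm
  is not unique, it suffices that one of the optimal arms is covered by \<open>Ns\<close> samples.
\<close>

definition problems ::
  "nat \<Rightarrow> (nat \<Rightarrow> nat) \<Rightarrow> nat \<Rightarrow> nat \<Rightarrow> nat \<Rightarrow> ((nat \<Rightarrow> real measure) \<times> nat list \<times> nat set) set" where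
  "problems m N Ns k a0 =
     {(R, acts, U). bandit m R \<and> (\<exists>a. optimal_arm m R a \<and> Ns \<le> N a) \<and>
        set acts \<subseteq> {..<m} \<and> (\<forall>a<m. count_list acts a = N a) \<and>
        U \<subseteq> {i. i < length acts \<and> acts ! i = a0} \<and> card U = k}"

section \<open>Learning--unlearning pairs\<close>

text \<open>
  The stored statistic. The fields are those used by the single-source algorithm, but no generality
  is lost for other algorithms: \<open>score\<close> is an arbitrary sequence of reals, into which any
  dataset together with any further finite or countable information can be encoded.
\<close>

record statistic =
  score :: "nat \<Rightarrow> real"
  avg :: "nat \<Rightarrow> real"
  counts :: "nat \<Rightarrow> nat"
  req_counts :: "nat \<Rightarrow> nat"
  learned :: "nat option"

text \<open>
  A pair (learner, unlearner) with its statistics. \<open>stat S D\<close> is the statistic \<open>T(D)\<close> in the run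
  on an actual request. \<open>ref_stat S D' c u l\<close> is the statistic stored in the reference run on
  \<open>D' = D \<setminus> U\<close>: besides \<open>D'\<close>, it may depend on the count vectors \<open>c\<close> of \<open>D\<close> and \<open>u\<close> of \<open>U\<close>
  and, if made available, on the arm \<open>l\<close> learned from \<open>D\<close>. The request \<open>None\<close> is the
  fictitious request of the reference run.
\<close>

record pair =
  learn :: "dataset \<Rightarrow> nat pmf"
  stat :: "dataset \<Rightarrow> statistic"
  ref_stat :: "dataset \<Rightarrow> (nat \<Rightarrow> nat) \<Rightarrow> (nat \<Rightarrow> nat) \<Rightarrow> nat option \<Rightarrow> statistic"
  unlearn :: "dataset option \<Rightarrow> nat \<Rightarrow> statistic \<Rightarrow> nat pmf"

definition run :: "pair \<Rightarrow> dataset \<Rightarrow> nat set \<Rightarrow> nat pmf" where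
  "run S D U =
     bind_pmf (learn S D) (\<lambda>a. unlearn S (Some (nths D U)) a (stat S D))"

text \<open>
  The flag \<open>b\<close> tells whether the reference statistic may contain the arm learned from \<open>D\<close>. The
  single-source algorithm stores this arm; but then repeating the learned arm is an admissible way
  to unlearn. With \<open>b = False\<close> only the arm counts of the dataset and of the request are available,
  which leads to a smaller class of pairs and so to a larger infimum.
\<close>

definition ref_run :: "bool \<Rightarrow> pair \<Rightarrow> dataset \<Rightarrow> nat set \<Rightarrow> nat pmf" where
  "ref_run b S D U =
     bind_pmf (learn S D) (\<lambda>l.
     bind_pmf (learn S (nths D (- U))) (\<lambda>a.
       unlearn S None a
         (ref_stat S (nths D (- U)) (num D) (num (nths D U)) (if b then Some l else None))))"

text \<open>
  Pairs output arms only, and the output probabilities are measurable functions of the rewards (so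
  that expectations over the generation of the data are meaningful).
\<close>

definition valid_pair :: "nat \<Rightarrow> pair \<Rightarrow> bool" where
  "valid_pair m S \<longleftrightarrow>
     (\<forall>D. set_pmf (learn S D) \<subseteq> {..<m}) \<and>
     (\<forall>q a T. set_pmf (unlearn S q a T) \<subseteq> {..<m}) \<and>
     (\<forall>acts U a. set acts \<subseteq> {..<m} \<longrightarrow> U \<subseteq> {..<length acts} \<longrightarrow>
        (\<lambda>r. pmf (run S (data acts r) U) a)
          \<in> borel_measurable (\<Pi>\<^sub>M i\<in>{..<length acts}. (borel :: real measure)))"

definition unlearning :: "bool \<Rightarrow> nat \<Rightarrow> real \<Rightarrow> real \<Rightarrow> pair \<Rightarrow> bool" where
  "unlearning b m \<epsilon> \<delta> S \<longleftrightarrow>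
     (\<forall>D U A. dataset m D \<longrightarrow> U \<subseteq> {..<length D} \<longrightarrow> A \<subseteq> {..<m} \<longrightarrow>
        measure_pmf.prob (run S D U) A
          \<le> exp \<epsilon> * measure_pmf.prob (ref_run b S D U) A + \<delta> \<and>
        measure_pmf.prob (ref_run b S D U) A
          \<le> exp \<epsilon> * measure_pmf.prob (run S D U) A + \<delta>)"

definition expected_subopt ::
  "nat \<Rightarrow> (nat \<Rightarrow> real measure) \<Rightarrow> nat list \<Rightarrow> nat set \<Rightarrow> pair \<Rightarrow> real" where
  "expected_subopt m R acts U S =
     (\<integral>r. measure_pmf.expectation (run S (data acts r) U) (\<lambda>a. Max (mu R ` {..<m}) - mu R a)
        \<partial>rewards R acts)"

definition worst_subopt ::
  "nat \<Rightarrow> (nat \<Rightarrow> nat) \<Rightarrow> nat \<Rightarrow> nat \<Rightarrow> nat \<Rightarrow> pair \<Rightarrow> ereal" where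
  "worst_subopt m N Ns k a0 S =
     (SUP (R, acts, U) \<in> problems m N Ns k a0. ereal (expected_subopt m R acts U S))"

definition SubOpt ::
  "bool \<Rightarrow> nat \<Rightarrow> (nat \<Rightarrow> nat) \<Rightarrow> nat \<Rightarrow> nat \<Rightarrow> nat \<Rightarrow> real \<Rightarrow> real \<Rightarrow> ereal" where
  "SubOpt b m N Ns k a0 \<epsilon> \<delta> =
     (INF S \<in> {S. valid_pair m S \<and> unlearning b m \<epsilon> \<delta> S}. worst_subopt m N Ns k a0 S)"

section \<open>The LCB learner\<close>

definition emp_mean :: "dataset \<Rightarrow> nat \<Rightarrow> real" where
  "emp_mean D a = (if num D a = 0 then 0 else reward_sum D a / real (num D a))"

definition bonus :: "nat \<Rightarrow> real \<Rightarrow> dataset \<Rightarrow> nat \<Rightarrow> real" where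
  "bonus m \<tau> D a =
     (if num D a = 0 then 1 else sqrt (ln (real m / \<tau>) / (2 * real (num D a))))"

definition lcb :: "nat \<Rightarrow> real \<Rightarrow> dataset \<Rightarrow> nat \<Rightarrow> real" where
  "lcb m \<tau> D a = emp_mean D a - bonus m \<tau> D a"

definition lcb_arm :: "nat \<Rightarrow> real \<Rightarrow> dataset \<Rightarrow> nat" where
  "lcb_arm m \<tau> D = arg_max_on (lcb m \<tau> D) {..<m}"

section \<open>The single-source unlearning algorithm\<close>

definition gamma0 :: "nat \<Rightarrow> real \<Rightarrow> nat \<Rightarrow> nat \<Rightarrow> real" where
  "gamma0 m \<tau> n k = 4 / 3 * sqrt (pi * ln (real m / \<tau>) / (real n - real k))"

definition noise_sd :: "real \<Rightarrow> nat \<Rightarrow> nat \<Rightarrow> real" where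
  "noise_sd \<gamma> n k = 3 * real k / (2 * real n) * \<gamma>"

text \<open>
  The law of the arg max after adding \<open>\<nu> \<sim> \<N>(0, \<sigma>\<^sup>2)\<close> to the score of \<open>a0\<close>. Writing \<open>\<nu> = \<sigma> z\<close>
  with \<open>z\<close> standard normal also covers \<open>\<sigma> = 0\<close>, where \<^term>\<open>normal_density\<close> is degenerate.
\<close>

definition noisy_arg_max :: "nat \<Rightarrow> (nat \<Rightarrow> real) \<Rightarrow> nat \<Rightarrow> real \<Rightarrow> nat pmf" where
  "noisy_arg_max m F a0 \<sigma> =
     Abs_pmf (distr std_normal_distribution (count_space UNIV)
       (\<lambda>z. arg_max_on (F(a0 := F a0 + \<sigma> * z)) {..<m}))"

definition single_source_unlearn ::
  "nat \<Rightarrow> real \<Rightarrow> real \<Rightarrow> nat \<Rightarrow> dataset option \<Rightarrow> nat \<Rightarrow> statistic \<Rightarrow> nat pmf" where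
  "single_source_unlearn m \<tau> \<gamma> a0 q ahat T =
     (case q of
        Some U \<Rightarrow>
          (let n = counts T a0; k = length U in
           if ahat = a0 \<and> \<gamma> < gamma0 m \<tau> n k
           then noisy_arg_max m (score T) a0 (noise_sd \<gamma> n k)
           else return_pmf (arg_max_on ((score T)(a0 :=
                  (avg T a0 * real n - reward_sum U a0) / (real n - real k)
                    - sqrt (ln (real m / \<tau>) / (2 * (real n - real k))))) {..<m}))
      | None \<Rightarrow>
          (let n = counts T a0; k = req_counts T a0 in
           if learned T = Some a0 \<and> \<gamma> < gamma0 m \<tau> n k
           then noisy_arg_max m (score T) a0 (noise_sd \<gamma> n k)
           else return_pmf (arg_max_on (score T) {..<m})))"

definition single_source :: "nat \<Rightarrow> real \<Rightarrow> real \<Rightarrow> nat \<Rightarrow> pair" where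
  "single_source m \<tau> \<gamma> a0 =
     \<lparr>learn = (\<lambda>D. return_pmf (lcb_arm m \<tau> D)),
      stat = (\<lambda>D. \<lparr>score = lcb m \<tau> D, avg = emp_mean D, counts = num D,
                 req_counts = (\<lambda>_. 0), learned = None\<rparr>),
      ref_stat = (\<lambda>D' c u l. \<lparr>score = lcb m \<tau> D', avg = (\<lambda>_. 0), counts = c,
                           req_counts = u, learned = l\<rparr>),
      unlearn = single_source_unlearn m \<tau> \<gamma> a0\<rparr>"

end

theory Submission
  imports Defs
begin

text \<open>
  By Hoeffding's inequality, with probability at least \<open>1 - 4 / n\<close> the confidence intervals of all
  arms are correct, both on \<open>D\<close> and on \<open>D \<setminus> U\<close>. All scores are then below the true means, and an arm
  whose score is at least that of the optimal arm is nearly optimal. This bounds the loss of the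
  rollback; the Gaussian noise adds at most its standard deviation.

  For \<open>SubOpt\<close> the Gaussian mechanism is not used, because its privacy guarantee would need
  \<open>\<epsilon> \<le> 1\<close>. A statistic can encode the whole dataset, so it suffices to give two mechanisms that are
  close to each other. Rollback is exact and gives the bound for \<open>\<gamma> \<ge> \<gamma>\<^sub>0\<close>. In the other case only
  the score of \<open>a\<^sub>0\<close> depends on \<open>U\<close>, and it changes by at most \<open>k / N(a\<^sub>0)\<close> if the reference run
  divides by the stored count \<open>N(a\<^sub>0)\<close>. Choosing between \<open>a\<^sub>0\<close> and its best competitor with logistic
  probabilities at the scale \<open>k / (N(a\<^sub>0) \<epsilon>)\<close> therefore is pure \<open>\<epsilon>\<close>-unlearning and costs
  \<open>k / (N(a\<^sub>0) \<epsilon>) \<le> 2 k \<gamma> / N(a\<^sub>0)\<close> in expectation.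
\<close>

section \<open>Arg max over a finite set: attainment and measurability\<close>

lemma arg_max_on_mem_ge:
  fixes f :: "'a \<Rightarrow> real"
  assumes "finite S" "S \<noteq> {}"
  shows "arg_max_on f S \<in> S" "\<And>y. y \<in> S \<Longrightarrow> f y \<le> f (arg_max_on f S)"
proof -
  have "Max (f ` S) \<in> f ` S"
    using assms by (intro Max_in) auto
  then obtain x where x: "x \<in> S" "f x = Max (f ` S)"
    by (elim imageE) simp
  then have "is_arg_max f (\<lambda>x. x \<in> S) x"
    using assms(1) by (auto simp: is_arg_max_linorder)
  then have "is_arg_max f (\<lambda>x. x \<in> S) (arg_max_on f S)"
    unfolding arg_max_on_def arg_max_def by (rule someI)
  then show "arg_max_on f S \<in> S" "\<And>y. y \<in> S \<Longrightarrow> f y \<le> f (arg_max_on f S)"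
    by (auto simp: is_arg_max_linorder)
qed

lemma arg_max_on_cong:
  fixes f g :: "'a \<Rightarrow> real"
  assumes "\<And>x. x \<in> S \<Longrightarrow> f x = g x"
  shows "arg_max_on f S = arg_max_on g S"
proof -
  have "is_arg_max f (\<lambda>x. x \<in> S) = is_arg_max g (\<lambda>x. x \<in> S)"
    using assms by (auto simp: is_arg_max_linorder fun_eq_iff)
  then show ?thesis by (simp add: arg_max_on_def arg_max_def)
qed

text \<open>\<open>arg_max_on\<close> is a fixed choice from the set of maximisers. That set ranges
  over the finite \<open>Pow S\<close>, each of its values is singled out by finitely many
  comparisons of measurable functions, and on a count space every choice function is measurable.
  This covers any way of breaking ties.\<close>

lemma measurable_arg_max_on:
  fixes F :: "'a \<Rightarrow> 'b \<Rightarrow> real"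
  assumes S: "finite S" and F: "\<And>a. a \<in> S \<Longrightarrow> (\<lambda>x. F x a) \<in> borel_measurable M"
  shows "(\<lambda>x. arg_max_on (F x) S) \<in> measurable M (count_space UNIV)"
proof -
  define A where "A x = {a \<in> S. \<forall>y\<in>S. F x y \<le> F x a}" for x
  have A: "A \<in> measurable M (count_space (Pow S))"
    unfolding measurable_count_space_eq2[OF finite_Pow_iff[THEN iffD2, OF S]]
  proof (intro conjI ballI)
    fix B assume B: "B \<in> Pow S"
    have *: "A x = B \<longleftrightarrow> (\<forall>a\<in>S. a \<in> B \<longleftrightarrow> (\<forall>y\<in>S. F x y \<le> F x a))" for x
      unfolding A_def set_eq_iff mem_Collect_eq using B by (metis PowD subsetD)
    have "A -` {B} \<inter> space M = {x \<in> space M. \<forall>a\<in>S. a \<in> B \<longleftrightarrow> (\<forall>y\<in>S. F x y \<le> F x a)}"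
      unfolding vimage_def *[symmetric] by blast
    also have "\<dots> \<in> sets M"
    proof (rule sets.sets_Collect_finite_All[OF _ S])
      fix a assume a: "a \<in> S"
      have *: "{x \<in> space M. \<forall>y\<in>S. F x y \<le> F x a} \<in> sets M"
        by (rule sets.sets_Collect_finite_All[OF _ S]) (intro borel_measurable_le F a)
      show "{x \<in> space M. a \<in> B \<longleftrightarrow> (\<forall>y\<in>S. F x y \<le> F x a)} \<in> sets M"
        using * sets.sets_Collect_neg[OF *] by (cases "a \<in> B") (simp_all only: simp_thms)
    qed
    finally show "A -` {B} \<inter> space M \<in> sets M" .
  qed (auto simp: A_def)
  have "(\<lambda>B. SOME a. a \<in> B) \<in> measurable (count_space (Pow S)) (count_space UNIV)"
    by simp
  from measurable_compose[OF A this] have "(\<lambda>x. SOME a. a \<in> A x) \<in> measurable M (count_space UNIV)" .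
  then show ?thesis
    unfolding A_def arg_max_on_def arg_max_def is_arg_max_linorder mem_Collect_eq Ball_def .
qed

section \<open>Counts and reward sums as sums over positions\<close>

lemma sum_list_nths:
  "(\<Sum>x\<leftarrow>nths xs U. g x) = (\<Sum>i | i < length xs \<and> i \<in> U. g (xs ! i))"
proof (induction xs rule: rev_induct)
  case (snoc x xs)
  have *: "{i. i < length (xs @ [x]) \<and> i \<in> U}
      = {i. i < length xs \<and> i \<in> U} \<union> (if length xs \<in> U then {length xs} else {})"
    by (auto simp: less_Suc_eq)
  have "(\<Sum>i | i < length xs \<and> i \<in> U. g ((xs @ [x]) ! i)) = (\<Sum>i | i < length xs \<and> i \<in> U. g (xs ! i))"
    by (intro sum.cong) (auto simp: nth_append)
  then show ?case
    unfolding * using snoc by (subst sum.union_disjoint) (auto simp: nths_append)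
qed simp

lemma num_eq_sum_list: "num D a = (\<Sum>p\<leftarrow>D. if fst p = a then 1 else 0)"
  by (induction D) (auto simp: num_def)

lemma reward_sum_eq_sum_list: "reward_sum D a = (\<Sum>p\<leftarrow>D. if fst p = a then snd p else 0)"
  by (induction D) (auto simp: reward_sum_def)

lemma sum_list_nths_compl:
  fixes g :: "'a \<Rightarrow> 'b::comm_monoid_add"
  shows "(\<Sum>x\<leftarrow>nths xs U. g x) + (\<Sum>x\<leftarrow>nths xs (- U). g x) = (\<Sum>x\<leftarrow>xs. g x)"
proof -
  have "(\<Sum>x\<leftarrow>xs. g x) = (\<Sum>x\<leftarrow>nths xs UNIV. g x)"
    by (simp add: nths_all)
  also have "\<dots> = (\<Sum>i\<in>{i. i < length xs \<and> i \<in> U} \<union> {i. i < length xs \<and> i \<in> - U}. g (xs ! i))"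
    unfolding sum_list_nths by (intro sum.cong) auto
  finally show ?thesis
    by (subst (asm) sum.union_disjoint) (auto simp: sum_list_nths)
qed

lemma num_nths_compl: "num D a = num (nths D U) a + num (nths D (- U)) a"
  by (simp only: num_eq_sum_list sum_list_nths_compl)

lemma reward_sum_nths_compl:
  "reward_sum D a = reward_sum (nths D U) a + reward_sum (nths D (- U)) a"
  by (simp only: reward_sum_eq_sum_list sum_list_nths_compl)

text \<open>Index sets replace sublists from here on: the samples of \<open>a\<close> in
  \<open>D\<close> and in \<open>D \<setminus> U\<close> become \<open>pos acts a\<close> and
  \<open>pos acts a \<inter> - U\<close>, so that empirical means are averages of independent
  coordinates.\<close>

definition pos :: "nat list \<Rightarrow> nat \<Rightarrow> nat set" where
  "pos acts a = {i. i < length acts \<and> acts ! i = a}"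

lemma finite_pos [simp]: "finite (pos acts a)"
  by (simp add: pos_def)

lemma length_data [simp]: "length (data acts r) = length acts"
  by (simp add: data_def)

lemma data_nth: "i < length acts \<Longrightarrow> data acts r ! i = (acts ! i, r i)"
  by (simp add: data_def)

lemma num_nths_data: "num (nths (data acts r) U) a = card (pos acts a \<inter> U)"
proof -
  have "num (nths (data acts r) U) a
      = (\<Sum>i | i < length acts \<and> i \<in> U. if i \<in> pos acts a \<inter> U then 1 else 0)"
    unfolding num_eq_sum_list sum_list_nths
    by (intro sum.cong) (auto simp: data_nth pos_def)
  also have "\<dots> = (\<Sum>i\<in>pos acts a \<inter> U. 1)"
    by (intro sum.mono_neutral_cong_right) (auto simp: pos_def)
  finally show ?thesis by simp
qed

lemma reward_sum_nths_data: "reward_sum (nths (data acts r) U) a = (\<Sum>i\<in>pos acts a \<inter> U. r i)"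
proof -
  have "reward_sum (nths (data acts r) U) a
      = (\<Sum>i | i < length acts \<and> i \<in> U. if i \<in> pos acts a \<inter> U then r i else 0)"
    unfolding reward_sum_eq_sum_list sum_list_nths
    by (intro sum.cong) (auto simp: data_nth pos_def)
  also have "\<dots> = (\<Sum>i\<in>pos acts a \<inter> U. r i)"
    by (intro sum.mono_neutral_cong_right) (auto simp: pos_def)
  finally show ?thesis .
qed

lemma num_data: "num (data acts r) a = card (pos acts a)"
  using num_nths_data[of acts r UNIV a] by (simp add: nths_all)

lemma reward_sum_data: "reward_sum (data acts r) a = (\<Sum>i\<in>pos acts a. r i)"
  using reward_sum_nths_data[of acts r UNIV a] by (simp add: nths_all)

lemma card_pos: "card (pos acts a) = count_list acts a"
proof -
  have "map fst (data acts (\<lambda>_. 0)) = acts"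
    by (simp add: data_def map_nth comp_def)
  then show ?thesis
    using num_data[of acts "\<lambda>_. 0" a] by (simp add: num_def)
qed

text \<open>Taking the index set as an argument lets one statement serve both \<open>D\<close> and
  \<open>D \<setminus> U\<close>. The value -1 is the empirical mean 0 minus the bonus 1 of an
  unsampled arm.\<close>

definition lcb_score :: "real \<Rightarrow> nat set \<Rightarrow> (nat \<Rightarrow> real) \<Rightarrow> real" where
  "lcb_score L I r =
     (if I = {} then -1 else (\<Sum>i\<in>I. r i) / real (card I) - sqrt (L / (2 * real (card I))))"

lemma lcb_nths_data:
  "lcb m \<tau> (nths (data acts r) U) a = lcb_score (ln (real m / \<tau>)) (pos acts a \<inter> U) r"
  by (auto simp: lcb_def emp_mean_def bonus_def lcb_score_def num_nths_data reward_sum_nths_data)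

lemma lcb_data: "lcb m \<tau> (data acts r) a = lcb_score (ln (real m / \<tau>)) (pos acts a) r"
  using lcb_nths_data[of m \<tau> acts r UNIV a] by (simp add: nths_all)

section \<open>Concentration of the empirical means\<close>

text \<open>The half-width is the LCB bonus itself, so the score of a sampled good arm lies between
  the mean minus twice the bonus and the mean. Without samples the score -1 is below every mean
  anyway.\<close>

definition good :: "real \<Rightarrow> (nat \<Rightarrow> real measure) \<Rightarrow> nat \<Rightarrow> nat set \<Rightarrow> (nat \<Rightarrow> real) \<Rightarrow> bool" where
  "good L R a I r \<longleftrightarrow>
     I = {} \<or> \<bar>(\<Sum>i\<in>I. r i) / real (card I) - mu R a\<bar> \<le> sqrt (L / (2 * real (card I)))"

lemma bandit_mu_bounds:
  assumes "bandit m R" "a < m"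
  shows "0 \<le> mu R a" "mu R a \<le> 1"
proof -
  interpret prob_space "R a" using assms by (auto simp: bandit_def)
  have [measurable_cong]: "sets (R a) = sets borel" using assms by (auto simp: bandit_def)
  have ae: "AE x in R a. x \<in> {0..1}" using assms by (auto simp: bandit_def)
  have "integrable (R a) (\<lambda>x. x)"
    by (rule integrable_const_bound[where B = 1]) (use ae in auto)
  then show "0 \<le> mu R a" "mu R a \<le> 1"
    unfolding mu_def using ae
    by (auto intro!: integral_ge_const integral_le_const)
qed

lemma good_lcb_score_le:
  assumes "good L R a I r" "0 \<le> mu R a"
  shows "lcb_score L I r \<le> mu R a"
  using assms by (auto simp: good_def lcb_score_def)

lemma good_le_lcb_score:
  assumes "good L R a I r" "I \<noteq> {}"
  shows "mu R a - 2 * sqrt (L / (2 * real (card I))) \<le> lcb_score L I r"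
  using assms by (auto simp: good_def lcb_score_def)

context
  fixes m :: nat and R :: "nat \<Rightarrow> real measure" and acts :: "nat list"
  assumes R: "bandit m R" and acts: "set acts \<subseteq> {..<m}"
begin

lemma bandit_nth:
  assumes "i < length acts"
  shows "prob_space (R (acts ! i))" "sets (R (acts ! i)) = sets borel"
    "AE x in R (acts ! i). x \<in> {0..1}"
  using R acts assms by (auto simp: bandit_def subset_iff)

lemma prob_space_rewards: "prob_space (rewards R acts)"
  unfolding rewards_def by (intro prob_space_PiM) (use bandit_nth in auto)

lemma sets_rewards [measurable_cong]:
  "sets (rewards R acts) = sets (\<Pi>\<^sub>M i\<in>{..<length acts}. borel)"
  unfolding rewards_def by (intro sets_PiM_cong) (use bandit_nth in auto)

lemma measurable_coord: "i < length acts \<Longrightarrow> (\<lambda>r. r i) \<in> borel_measurable (rewards R acts)"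
  unfolding measurable_cong_sets[OF sets_rewards refl]
  by (intro measurable_component_singleton) auto

lemma distr_rewards_component:
  assumes "i < length acts"
  shows "distr (rewards R acts) borel (\<lambda>r. r i) = R (acts ! i)"
proof -
  have "distr (rewards R acts) borel (\<lambda>r. r i) = distr (rewards R acts) (R (acts ! i)) (\<lambda>r. r i)"
    using bandit_nth[OF assms] by (intro distr_cong) auto
  also have "\<dots> = R (acts ! i)"
    unfolding rewards_def by (rule distr_PiM_component) (use assms bandit_nth in auto)
  finally show ?thesis .
qed

text \<open>The joint law of the coordinates is the product measure itself, and its factors are
  their marginals. This characterises independence over a nonempty index set; the empty list is
  treated apart.\<close>

lemma indep_vars_rewards:
  "prob_space.indep_vars (rewards R acts) (\<lambda>_. borel) (\<lambda>i r. r i) {..<length acts}"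
proof (cases "acts = []")
  case True
  interpret prob_space "rewards R acts" by (rule prob_space_rewards)
  have "indep_vars (\<lambda>_. borel) (\<lambda>i r. r i) {}"
    by (simp add: indep_vars_def indep_sets_def)
  then show ?thesis by (simp add: True)
next
  case False
  interpret prob_space "rewards R acts" by (rule prob_space_rewards)
  show ?thesis
  proof (subst indep_vars_iff_distr_eq_PiM')
    show "{..<length acts} \<noteq> {}" using False by (auto simp: lessThan_empty_iff)
    have "distr (rewards R acts) (\<Pi>\<^sub>M i\<in>{..<length acts}. borel) (\<lambda>r. \<lambda>i\<in>{..<length acts}. r i)
      = distr (rewards R acts) (rewards R acts) (\<lambda>r. r)"
      by (intro distr_cong) (simp_all add: sets_rewards, simp add: space_PiM rewards_def PiE_def extensional_restrict)
    also have "\<dots> = (\<Pi>\<^sub>M i\<in>{..<length acts}. distr (rewards R acts) borel (\<lambda>r. r i))"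
      unfolding distr_id2[OF refl]
      by (subst rewards_def, intro PiM_cong refl) (simp add: distr_rewards_component)
    finally show "distr (rewards R acts) (\<Pi>\<^sub>M i\<in>{..<length acts}. borel)
        (\<lambda>r. \<lambda>i\<in>{..<length acts}. r i)
      = (\<Pi>\<^sub>M i\<in>{..<length acts}. distr (rewards R acts) borel (\<lambda>r. r i))" .
  qed (auto intro: measurable_coord)
qed

lemma measurable_good [measurable]:
  assumes "I \<subseteq> {..<length acts}"
  shows "Measurable.pred (rewards R acts) (good L R a I)"
proof -
  have [measurable]: "(\<lambda>r. r i) \<in> borel_measurable (rewards R acts)" if "i \<in> I" for i
    using that assms by (intro measurable_coord) auto
  show ?thesis unfolding good_def by measurable
qed

text \<open>Two-sided Hoeffding inequality for variables in [0,1]. The set \<open>I\<close> is fixed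
  before the rewards are drawn; this is where requests chosen without looking at the rewards
  matter.\<close>

lemma prob_not_good:
  assumes I: "I \<subseteq> pos acts a" and L: "0 \<le> L"
  shows "measure (rewards R acts) {r \<in> space (rewards R acts). \<not> good L R a I r} \<le> 2 * exp (- L)"
proof (cases "I = {}")
  case True
  then show ?thesis by (simp add: good_def)
next
  case False
  have I': "I \<subseteq> {..<length acts}" and nth: "\<And>i. i \<in> I \<Longrightarrow> acts ! i = a"
    using I by (auto simp: pos_def)
  have fin: "finite I" using I' finite_subset by blast
  with False have n: "real (card I) > 0" by (simp add: card_gt_0_iff)
  interpret prob_space "rewards R acts" by (rule prob_space_rewards)
  interpret H: indep_interval_bounded_random_variables "rewards R acts" I "\<lambda>i r. r i" "\<lambda>_. 0" "\<lambda>_. 1"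
  proof
    show "finite I" by fact
    show "indep_vars (\<lambda>_. borel) (\<lambda>i r. r i) I"
      by (rule indep_vars_subset[OF indep_vars_rewards I'])
    fix i assume i: "i \<in> I"
    show "AE r in rewards R acts. r i \<in> {0..1}"
      unfolding rewards_def by (rule AE_PiM_component) (use bandit_nth i I' in auto)
  qed
  have E: "expectation (\<lambda>r. r i) = mu R a" if "i \<in> I" for i
  proof -
    have i: "i < length acts" using that I' by auto
    have "expectation (\<lambda>r. r i) = (\<integral>x. x \<partial>distr (rewards R acts) borel (\<lambda>r. r i))"
      by (rule integral_distr[symmetric]) (auto intro: measurable_coord i)
    then show ?thesis using i nth that by (simp add: distr_rewards_component mu_def)
  qed
  interpret H: Hoeffding_ineq "rewards R acts" I "\<lambda>i r. r i" "\<lambda>_. 0" "\<lambda>_. 1" "real (card I) * mu R a"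
    by unfold_locales (simp add: E)
  \<comment> \<open>\<open>s\<close> is \<open>card I\<close> times the half-width, so that the
    Hoeffding exponent \<open>2 * s\<^sup>2 / card I\<close> equals \<open>L\<close>.\<close>
  define s where "s = sqrt (real (card I) * L / 2)"
  have s: "s = real (card I) * sqrt (L / (2 * real (card I)))"
  proof -
    have "s = sqrt ((real (card I))\<^sup>2 * (L / (2 * real (card I))))"
      using n by (simp add: s_def power2_eq_square)
    then show ?thesis using n by (simp only: real_sqrt_mult real_sqrt_abs)
  qed
  have [measurable]: "(\<lambda>r. r i) \<in> borel_measurable (rewards R acts)" if "i \<in> I" for i
    using that I' by (intro measurable_coord) auto
  have "prob {r \<in> space (rewards R acts). \<not> good L R a I r}
      \<le> prob {r \<in> space (rewards R acts). \<bar>(\<Sum>i\<in>I. r i) - real (card I) * mu R a\<bar> \<ge> s}"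
  proof (rule finite_measure_mono)
    show "{r \<in> space (rewards R acts). \<not> good L R a I r}
      \<subseteq> {r \<in> space (rewards R acts). \<bar>(\<Sum>i\<in>I. r i) - real (card I) * mu R a\<bar> \<ge> s}"
    proof safe
      fix r assume "\<not> good L R a I r"
      then have "sqrt (L / (2 * real (card I))) \<le> \<bar>(\<Sum>i\<in>I. r i) / real (card I) - mu R a\<bar>"
        by (simp add: good_def)
      also have "(\<Sum>i\<in>I. r i) / real (card I) - mu R a
          = ((\<Sum>i\<in>I. r i) - real (card I) * mu R a) / real (card I)"
        using n by (simp add: field_simps)
      finally show "s \<le> \<bar>(\<Sum>i\<in>I. r i) - real (card I) * mu R a\<bar>"
        using n by (simp add: s abs_divide pos_le_divide_eq mult.commute)
    qed
  qed measurable
  also have "\<dots> \<le> 2 * exp (- 2 * s\<^sup>2 / (\<Sum>i\<in>I. (1 - 0)\<^sup>2))"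
    by (rule H.Hoeffding_ineq_abs_ge) (use n L in \<open>auto simp: s_def\<close>)
  also have "- 2 * s\<^sup>2 / (\<Sum>i\<in>I. (1 - 0)\<^sup>2) = - L"
    using n L by (simp add: s_def)
  finally show ?thesis .
qed

end

section \<open>The noisy arg max\<close>

lemma arg_max_on_less:
  fixes f :: "nat \<Rightarrow> real"
  assumes "0 < m"
  shows "arg_max_on f {..<m} < m" "\<And>y. y < m \<Longrightarrow> f y \<le> f (arg_max_on f {..<m})"
  using arg_max_on_mem_ge[of "{..<m}"] assms by (auto simp: lessThan_empty_iff)

text \<open>\<open>Abs_pmf\<close> is meaningful only for a discrete probability measure. A
  probability measure on the countable type \<open>nat\<close> is concentrated on its atoms, so it
  suffices that the arg max is measurable in \<open>z\<close>.\<close>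

lemma measure_pmf_noisy_arg_max:
  "measure_pmf (noisy_arg_max m F a0 \<sigma>)
     = distr std_normal_distribution (count_space UNIV)
         (\<lambda>z. arg_max_on (F(a0 := F a0 + \<sigma> * z)) {..<m})" (is "_ = ?D")
  and measurable_noisy_arg_max:
  "(\<lambda>z. arg_max_on (F(a0 := F a0 + \<sigma> * z)) {..<m}) \<in> measurable std_normal_distribution (count_space UNIV)"
proof -
  show X: "(\<lambda>z. arg_max_on (F(a0 := F a0 + \<sigma> * z)) {..<m})
      \<in> measurable std_normal_distribution (count_space UNIV)"
    by (intro measurable_arg_max_on) (auto simp: fun_upd_def)
  interpret S: prob_space std_normal_distribution by (rule prob_space_normal_density) simp
  interpret D: prob_space ?D by (rule S.prob_space_distr[OF X])
  have "AE x in ?D. measure ?D {x} \<noteq> 0"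
    by (subst D.AE_support_countable) (auto intro!: exI[of _ UNIV])
  then show "measure_pmf (noisy_arg_max m F a0 \<sigma>) = ?D"
    unfolding noisy_arg_max_def by (intro Abs_pmf_inverse) (auto intro: D.prob_space_axioms)
qed

lemma expectation_noisy_arg_max:
  fixes g :: "nat \<Rightarrow> real"
  shows "measure_pmf.expectation (noisy_arg_max m F a0 \<sigma>) g
    = (\<integral>z. g (arg_max_on (F(a0 := F a0 + \<sigma> * z)) {..<m}) \<partial>std_normal_distribution)"
  unfolding measure_pmf_noisy_arg_max
  by (rule integral_distr[OF measurable_noisy_arg_max]) simp

lemma set_pmf_noisy_arg_max:
  assumes "0 < m"
  shows "set_pmf (noisy_arg_max m F a0 \<sigma>) \<subseteq> {..<m}"
proof
  fix x assume "x \<in> set_pmf (noisy_arg_max m F a0 \<sigma>)"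
  then have *: "measure (measure_pmf (noisy_arg_max m F a0 \<sigma>)) {x} \<noteq> 0"
    by (simp add: set_pmf.rep_eq)
  show "x \<in> {..<m}"
  proof (rule ccontr)
    assume x: "x \<notin> {..<m}"
    have "(\<lambda>z. arg_max_on (F(a0 := F a0 + \<sigma> * z)) {..<m}) -` {x} = {}"
      using x arg_max_on_less[OF assms] by auto
    then show False
      using * unfolding measure_pmf_noisy_arg_max
      by (subst (asm) measure_distr[OF measurable_noisy_arg_max]) auto
  qed
qed

text \<open>If \<open>a0\<close> maximises \<open>F\<close>, an arm that overtakes it has score at least \<open>F a0 - \<sigma> \<bar>z\<bar>\<close>.\<close>

lemma expectation_noisy_arg_max_le:
  fixes F g :: "nat \<Rightarrow> real"
  assumes m: "0 < m" and a0: "a0 < m" and \<sigma>: "0 \<le> \<sigma>" and \<beta>: "0 \<le> \<beta>"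
    and g: "\<And>a. a < m \<Longrightarrow> g a \<le> M - F a" and F: "M - F a0 \<le> \<beta>"
  shows "measure_pmf.expectation (noisy_arg_max m F a0 \<sigma>) g \<le> \<beta> + \<sigma>"
proof -
  interpret S: prob_space std_normal_distribution by (rule prob_space_normal_density) simp
  have z2: "integrable std_normal_distribution (\<lambda>z. z\<^sup>2)"
    "(\<integral>z. z\<^sup>2 \<partial>std_normal_distribution) = 1"
    using std_normal_distribution_even_moments[of 1] by simp_all
  have "g (arg_max_on (F(a0 := F a0 + \<sigma> * z)) {..<m}) \<le> (\<beta> + \<sigma> / 2) + \<sigma> / 2 * z\<^sup>2" for z
  proof -
    define a where "a = arg_max_on (F(a0 := F a0 + \<sigma> * z)) {..<m}"
    have a: "a < m" and ge: "(F(a0 := F a0 + \<sigma> * z)) a0 \<le> (F(a0 := F a0 + \<sigma> * z)) a"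
      using arg_max_on_less[OF m] a0 unfolding a_def by blast+
    \<comment> \<open>With this quadratic bound the second moment 1 of \<open>z\<close> is enough;
      the two halves \<open>\<sigma> / 2\<close> add up to \<open>\<sigma>\<close>.\<close>
    have z: "\<bar>z\<bar> \<le> (1 + z\<^sup>2) / 2"
      using zero_le_power2[of "\<bar>z\<bar> - 1"] by (simp add: power2_diff)
    have "g a \<le> \<beta> + \<sigma> * \<bar>z\<bar>"
    proof (cases "a = a0")
      case True
      then show ?thesis using g[OF a] F \<sigma> by (simp add: add_increasing2)
    next
      case False
      then have "F a0 + \<sigma> * z \<le> F a" using ge by simp
      moreover have "- (\<sigma> * z) \<le> \<sigma> * \<bar>z\<bar>"
        using \<sigma> mult_left_mono[of "-z" "\<bar>z\<bar>" \<sigma>] by simp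
      ultimately show ?thesis using g[OF a] F by linarith
    qed
    also have "\<dots> \<le> \<beta> + \<sigma> * ((1 + z\<^sup>2) / 2)"
      using z \<sigma> by (intro add_left_mono mult_left_mono)
    finally show ?thesis unfolding a_def by (simp add: algebra_simps add_divide_distrib)
  qed
  then have "measure_pmf.expectation (noisy_arg_max m F a0 \<sigma>) g
      \<le> (\<integral>z. (\<beta> + \<sigma> / 2) + \<sigma> / 2 * z\<^sup>2 \<partial>std_normal_distribution)"
    unfolding expectation_noisy_arg_max
    using \<sigma> \<beta> z2 by (intro integral_mono') auto
  also have "\<dots> = \<beta> + \<sigma>"
    using z2 S.prob_space by (subst Bochner_Integration.integral_add) auto
  finally show ?thesis .
qed

section \<open>The good event of a bandit problem\<close>

locale bandit_problem =
  fixes m :: nat and N :: "nat \<Rightarrow> nat" and Ns k a0 n :: nat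
    and R :: "nat \<Rightarrow> real measure" and acts :: "nat list" and U :: "nat set"
  assumes m: "2 \<le> m" and a0: "a0 < m" and Ns: "0 < Ns"
    and n: "n = (\<Sum>a<m. N a)" and k: "k < N a0"
    and problem: "(R, acts, U) \<in> problems m N Ns k a0"
begin

definition L :: real where
  "L = ln (real m / (1 / real n))"

definition loss :: "nat \<Rightarrow> real" where
  "loss a = Max (mu R ` {..<m}) - mu R a"

text \<open>The intervals on \<open>D\<close> control the scores seen by the learner, those on
  \<open>D \<setminus> U\<close> the scores after a rollback.\<close>

definition good_event :: "(nat \<Rightarrow> real) \<Rightarrow> bool" where
  "good_event r \<longleftrightarrow>
     (\<forall>a<m. good L R a (pos acts a) r \<and> good L R a (pos acts a \<inter> - U) r)"

lemma bandit: "bandit m R" and acts: "set acts \<subseteq> {..<m}"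
  and U: "U \<subseteq> pos acts a0" and card_U: "card U = k"
  and N: "\<And>a. a < m \<Longrightarrow> card (pos acts a) = N a"
  using problem by (auto simp: problems_def card_pos) (auto simp: pos_def)

lemma U_length: "U \<subseteq> {..<length acts}"
  using U by (auto simp: pos_def)

lemma pos_Un: "a \<noteq> a0 \<Longrightarrow> pos acts a \<inter> - U = pos acts a"
  using U by (auto simp: pos_def)

lemma card_rest: "card (pos acts a0 \<inter> - U) = N a0 - k"
proof -
  have "pos acts a0 \<inter> - U = pos acts a0 - U" by auto
  then show ?thesis
    using U card_U N[OF a0] finite_subset[OF U] by (simp add: card_Diff_subset)
qed

lemma obtain_optimal:
  obtains s where "s < m" "Ns \<le> N s" "Max (mu R ` {..<m}) = mu R s" "\<And>a. a < m \<Longrightarrow> mu R a \<le> mu R s"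
proof -
  obtain s where s: "optimal_arm m R s" "Ns \<le> N s"
    using problem by (auto simp: problems_def)
  then have "s < m" "\<And>a. a < m \<Longrightarrow> mu R a \<le> mu R s"
    by (auto simp: optimal_arm_def is_arg_max_linorder)
  moreover from this have "Max (mu R ` {..<m}) = mu R s"
    by (intro Max_eqI) auto
  ultimately show ?thesis using that s by simp
qed

lemma n_pos: "0 < n" and Ns_le_n: "Ns \<le> n"
proof -
  obtain s where s: "s < m" "Ns \<le> N s" by (rule obtain_optimal)
  have "N s \<le> n" unfolding n using s by (intro member_le_sum) auto
  with s Ns show "0 < n" "Ns \<le> n" by auto
qed

lemma exp_L: "exp (- L) = 1 / (real m * real n)"
  using n_pos m by (simp add: L_def exp_minus field_simps)

lemma L_ge: "1 / 4 \<le> L"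
proof -
  have "2 * 1 \<le> real m * real n"
    using m n_pos by (intro mult_mono) auto
  then have "ln 2 \<le> L" unfolding L_def by (subst ln_le_cancel_iff) (use m n_pos in auto)
  then show ?thesis using ln2_ge_two_thirds by simp
qed

text \<open>Absorbs the failure probability into the coverage term of the optimal arm:
  \<open>Ns \<le> n\<close> and \<open>1 / 4 \<le> L\<close> give
  \<open>1 / (2 * n) \<le> sqrt (L / Ns)\<close>.\<close>

lemma fail_le: "4 / real n \<le> 8 * sqrt (L / real Ns)"
proof -
  have "(1 / (2 * real n))\<^sup>2 \<le> L / real Ns"
  proof -
    have "(1 / (2 * real n))\<^sup>2 = (1 / 4) * (1 / (real n * real n))"
      by (simp add: power2_eq_square)
    also have "\<dots> \<le> (1 / 4) * (1 / real Ns)"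
    proof -
      have "real Ns * 1 \<le> real n * real n" using Ns_le_n n_pos by (intro mult_mono) auto
      then show ?thesis using Ns by (simp add: frac_le)
    qed
    also have "\<dots> \<le> L * (1 / real Ns)" using L_ge by (intro mult_right_mono) auto
    finally show ?thesis by simp
  qed
  then have "1 / (2 * real n) \<le> sqrt (L / real Ns)" by (rule real_le_rsqrt)
  then show ?thesis by simp
qed

lemma loss_bounds:
  assumes "a < m"
  shows "0 \<le> loss a" "loss a \<le> 1"
proof -
  obtain s where s: "s < m" "Max (mu R ` {..<m}) = mu R s" "mu R a \<le> mu R s"
    using obtain_optimal assms by metis
  show "0 \<le> loss a" "loss a \<le> 1"
    unfolding loss_def s(2) using s(3) bandit_mu_bounds[OF bandit s(1)] bandit_mu_bounds[OF bandit assms]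
    by linarith+
qed

lemma expectation_loss_le_1:
  assumes "set_pmf p \<subseteq> {..<m}"
  shows "measure_pmf.expectation p loss \<le> 1"
  using assms loss_bounds finite_subset[OF assms]
  by (intro measure_pmf.integral_le_const integrable_measure_pmf_finite)
     (auto simp: AE_measure_pmf_iff subset_iff)

lemma pos_rest_subset: "pos acts a \<subseteq> {..<length acts}" "pos acts a \<inter> - U \<subseteq> {..<length acts}"
  by (auto simp: pos_def)

lemma measurable_good_event [measurable]: "Measurable.pred (rewards R acts) good_event"
  unfolding good_event_def
  using measurable_good[OF bandit acts pos_rest_subset(1)]
    measurable_good[OF bandit acts pos_rest_subset(2)]
  by measurable

text \<open>Union bound over \<open>2 * m\<close> intervals, each failing with probability at most
  \<open>2 * exp (- L) = 2 / (m * n)\<close>. The level \<open>1 / n\<close> cancels the number of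
  arms here.\<close>

lemma prob_not_good_event:
  "measure (rewards R acts) {r \<in> space (rewards R acts). \<not> good_event r} \<le> 4 / real n"
proof -
  interpret prob_space "rewards R acts" by (rule prob_space_rewards[OF bandit acts])
  define B where "B I a = {r \<in> space (rewards R acts). \<not> good L R a I r}" for I a
  have B: "prob (B I a) \<le> 2 * exp (- L)" if "I \<subseteq> pos acts a" for I a
    unfolding B_def using that L_ge by (intro prob_not_good[OF bandit acts]) auto
  have [measurable]: "B (pos acts a) a \<in> events" "B (pos acts a \<inter> - U) a \<in> events" for a
    unfolding B_def
    using measurable_good[OF bandit acts pos_rest_subset(1), of L a a]
      measurable_good[OF bandit acts pos_rest_subset(2), of L a a]
    by measurable
  have "{r \<in> space (rewards R acts). \<not> good_event r}
      = (\<Union>a<m. B (pos acts a) a \<union> B (pos acts a \<inter> - U) a)"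
    by (auto simp: good_event_def B_def)
  also have "prob \<dots> \<le> (\<Sum>a<m. prob (B (pos acts a) a \<union> B (pos acts a \<inter> - U) a))"
    by (intro finite_measure_subadditive_finite) auto
  also have "\<dots> \<le> (\<Sum>a<m. 2 * exp (- L) + 2 * exp (- L))"
    by (intro sum_mono order_trans[OF measure_Un_le] add_mono B) auto
  also have "\<dots> = 4 / real n"
    using m n_pos by (simp add: exp_L field_simps)
  finally show ?thesis .
qed

text \<open>The loss is at most \<open>\<beta>\<close> on the good event and at most 1 off it. The
  integral is compared with an integrable nonnegative majorant, so \<open>p\<close> may depend on
  \<open>r\<close> in any way.\<close>

lemma expected_loss_le:
  assumes p: "\<And>r. set_pmf (p r) \<subseteq> {..<m}" and \<beta>: "0 \<le> \<beta>"
    and good: "\<And>r. good_event r \<Longrightarrow> measure_pmf.expectation (p r) loss \<le> \<beta>"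
  shows "(\<integral>r. measure_pmf.expectation (p r) loss \<partial>rewards R acts) \<le> \<beta> + 8 * sqrt (L / real Ns)"
proof -
  interpret prob_space "rewards R acts" by (rule prob_space_rewards[OF bandit acts])
  let ?B = "{r \<in> space (rewards R acts). \<not> good_event r}"
  have B: "?B \<in> events" by measurable
  then have int: "integrable (rewards R acts) (\<lambda>r. \<beta> + indicat_real ?B r)"
    by (intro Bochner_Integration.integrable_add integrable_const integrable_real_indicator)
      (auto simp: emeasure_eq_measure)
  have "measure_pmf.expectation (p r) loss \<le> \<beta> + indicator ?B r" if "r \<in> space (rewards R acts)" for r
    using good[of r] expectation_loss_le_1[OF p, of r] \<beta> that by (cases "good_event r") auto
  then have "(\<integral>r. measure_pmf.expectation (p r) loss \<partial>rewards R acts)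
      \<le> (\<integral>r. \<beta> + indicator ?B r \<partial>rewards R acts)"
    using int \<beta> by (intro integral_mono') auto
  also have "\<dots> = \<beta> + prob ?B"
    using B prob_space
    by (subst Bochner_Integration.integral_add) (auto intro!: integrable_real_indicator simp: emeasure_eq_measure)
  also have "\<dots> \<le> \<beta> + 8 * sqrt (L / real Ns)"
    using prob_not_good_event fail_le by simp
  finally show ?thesis .
qed

section \<open>Pessimism on the good event\<close>

definition full :: "(nat \<Rightarrow> real) \<Rightarrow> nat \<Rightarrow> real" where
  "full r a = lcb_score L (pos acts a) r"

definition rest :: "(nat \<Rightarrow> real) \<Rightarrow> nat \<Rightarrow> real" where
  "rest r a = lcb_score L (pos acts a \<inter> - U) r"

lemma lcb_eq_full: "lcb m (1 / real n) (data acts r) = full r"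
  by (rule ext) (simp add: lcb_data full_def L_def)

lemma rest_eq_full: "a \<noteq> a0 \<Longrightarrow> rest r a = full r a"
  by (simp add: rest_def full_def pos_Un)

lemma rest_a0:
  "rest r a0 = (reward_sum (data acts r) a0 - reward_sum (nths (data acts r) U) a0) / (real (N a0) - real k)
     - sqrt (L / (2 * (real (N a0) - real k)))"
proof -
  have "pos acts a0 \<inter> - U \<noteq> {}" using card_rest k by auto
  then show ?thesis
    using k reward_sum_nths_compl[of "data acts r" a0 U]
    by (simp add: rest_def lcb_score_def card_rest reward_sum_nths_data of_nat_diff)
qed

lemma full_le_mu: "good_event r \<Longrightarrow> a < m \<Longrightarrow> full r a \<le> mu R a"
  and rest_le_mu: "good_event r \<Longrightarrow> a < m \<Longrightarrow> rest r a \<le> mu R a"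
  using bandit_mu_bounds[OF bandit]
  by (auto simp: good_event_def full_def rest_def intro!: good_lcb_score_le)

text \<open>The winner scores at least as high as a well-covered optimal arm, whose score misses its
  mean by at most twice its bonus. The gap is measured to the score and not to the mean of
  \<open>b\<close>, because the randomised rules are analysed through perturbed scores.\<close>

lemma best_full_score:
  assumes r: "good_event r" and b: "b < m" "\<And>c. c < m \<Longrightarrow> full r c \<le> full r b"
  shows "Max (mu R ` {..<m}) - full r b \<le> 2 * sqrt (L / real Ns)"
proof -
  obtain s where s: "s < m" "Ns \<le> N s" "Max (mu R ` {..<m}) = mu R s" by (rule obtain_optimal)
  have "pos acts s \<noteq> {}" using N[OF s(1)] s(2) Ns by auto
  then have "mu R s - 2 * sqrt (L / (2 * real (N s))) \<le> full r s"
    using good_le_lcb_score[of L R s "pos acts s" r] r s(1) N[OF s(1)]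
    by (simp add: good_event_def full_def)
  moreover have "L / (2 * real (N s)) \<le> L / real Ns"
    using s Ns L_ge by (intro divide_left_mono) auto
  then have "sqrt (L / (2 * real (N s))) \<le> sqrt (L / real Ns)" by (rule real_sqrt_le_mono)
  ultimately show ?thesis
    using s(3) b(2)[OF s(1)] by linarith
qed

text \<open>Removing \<open>U\<close> thins out only \<open>a0\<close>. If the optimal arm is
  \<open>a0\<close>, it keeps \<open>N a0 - k\<close> samples, which gives the first term; otherwise
  it keeps all of its at least \<open>Ns\<close> samples.\<close>

lemma loss_le_rest:
  assumes r: "good_event r" and a: "a < m" and F: "\<And>c. c < m \<Longrightarrow> rest r c \<le> rest r a"
  shows "loss a \<le> 2 * max (sqrt (L / (real (N a0) - real k))) (sqrt (L / real Ns))"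
proof -
  obtain s where s: "s < m" "Ns \<le> N s" "Max (mu R ` {..<m}) = mu R s" by (rule obtain_optimal)
  let ?I = "pos acts s \<inter> - U"
  have c: "0 < card ?I" "sqrt (L / (2 * real (card ?I))) \<le> max (sqrt (L / (real (N a0) - real k))) (sqrt (L / real Ns))"
  proof -
    show "0 < card ?I" using N[OF s(1)] s(2) Ns card_rest k by (cases "s = a0") (auto simp: pos_Un)
    then have *: "L / (2 * real (card ?I)) \<le> L / real (card ?I)"
      using L_ge by (intro divide_left_mono) auto
    show "sqrt (L / (2 * real (card ?I))) \<le> max (sqrt (L / (real (N a0) - real k))) (sqrt (L / real Ns))"
    proof (cases "s = a0")
      case True
      then have "real (card ?I) = real (N a0) - real k" using card_rest k by simp
      then show ?thesis using real_sqrt_le_mono[OF *] by (metis max.coboundedI1)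
    next
      case False
      have "L / real (card ?I) \<le> L / real Ns"
        using False s Ns L_ge N[OF s(1)] by (intro divide_left_mono) (auto simp: pos_Un)
      then show ?thesis using real_sqrt_le_mono[OF order_trans[OF *]] by (metis max.coboundedI2)
    qed
  qed
  have "?I \<noteq> {}" using c(1) by auto
  then have "mu R s - 2 * sqrt (L / (2 * real (card ?I))) \<le> rest r s"
    using good_le_lcb_score[of L R s ?I r] r s(1) by (simp add: good_event_def rest_def)
  then show ?thesis
    unfolding loss_def using s(3) rest_le_mu[OF r a] F[OF s(1)] c(2) by linarith
qed

section \<open>The single-source algorithm\<close>

lemma lcb_arm_full:
  shows "lcb_arm m (1 / real n) (data acts r) < m"
    "c < m \<Longrightarrow> full r c \<le> full r (lcb_arm m (1 / real n) (data acts r))"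
  using arg_max_on_less[where m = m and f = "full r"] m
  by (auto simp: lcb_arm_def lcb_eq_full)

lemma run_single_source:
  "run (single_source m (1 / real n) \<gamma> a0) (data acts r) U =
     (if lcb_arm m (1 / real n) (data acts r) = a0 \<and> \<gamma> < gamma0 m (1 / real n) (N a0) k
      then noisy_arg_max m (full r) a0 (noise_sd \<gamma> (N a0) k)
      else return_pmf (arg_max_on (rest r) {..<m}))"
proof -
  have len: "length (nths (data acts r) U) = k"
  proof -
    have "{i. i < length acts \<and> i \<in> U} = U" using U_length by auto
    then show ?thesis by (simp add: length_nths card_U)
  qed
  have num: "num (data acts r) a0 = N a0" by (simp add: num_data N[OF a0])
  \<comment> \<open>The mean times the count is the full reward sum, so the rollback formula
    recomputes exactly the score of \<open>a0\<close> on \<open>D \<setminus> U\<close>.\<close>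
  have "(full r)(a0 := (emp_mean (data acts r) a0 * real (N a0) - reward_sum (nths (data acts r) U) a0) /
        (real (N a0) - real k) - sqrt (ln (real m / (1 / real n)) / (2 * (real (N a0) - real k)))) = rest r"
    using k num by (auto simp: fun_eq_iff rest_eq_full rest_a0 emp_mean_def L_def)
  then show ?thesis
    unfolding run_def single_source_def single_source_unlearn_def bind_return_pmf
    by (simp add: Let_def len num lcb_eq_full bind_return_pmf)
qed

lemma set_pmf_run_single_source:
  "set_pmf (run (single_source m (1 / real n) \<gamma> a0) (data acts r) U) \<subseteq> {..<m}"
  using arg_max_on_less(1)[where m = m and f = "rest r"] set_pmf_noisy_arg_max[of m] m
  by (auto simp: run_single_source)

lemma arg_max_rest:
  shows "arg_max_on (rest r) {..<m} < m" "c < m \<Longrightarrow> rest r c \<le> rest r (arg_max_on (rest r) {..<m})"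
  using arg_max_on_less[where m = m and f = "rest r"] m by auto

lemma expected_subopt_single_source_small:
  assumes "0 \<le> \<gamma>" and \<gamma>: "\<gamma> < gamma0 m (1 / real n) (N a0) k"
  shows "expected_subopt m R acts U (single_source m (1 / real n) \<gamma> a0)
    \<le> 10 * sqrt (L / real Ns) + 3 / 2 * (real k * \<gamma> / real (N a0))"
proof -
  have \<sigma>: "0 \<le> noise_sd \<gamma> (N a0) k" using assms by (simp add: noise_sd_def)
  have w: "0 \<le> sqrt (L / real Ns)" using L_ge by simp
  have "measure_pmf.expectation (run (single_source m (1 / real n) \<gamma> a0) (data acts r) U) loss
      \<le> 2 * sqrt (L / real Ns) + noise_sd \<gamma> (N a0) k" if r: "good_event r" for r
  proof (cases "lcb_arm m (1 / real n) (data acts r) = a0")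
    case True
    then have "Max (mu R ` {..<m}) - full r a0 \<le> 2 * sqrt (L / real Ns)"
      using lcb_arm_full(2)[of _ r] a0 by (intro best_full_score[OF r]) auto
    then have "measure_pmf.expectation (noisy_arg_max m (full r) a0 (noise_sd \<gamma> (N a0) k)) loss
        \<le> 2 * sqrt (L / real Ns) + noise_sd \<gamma> (N a0) k"
      using m a0 \<sigma> w full_le_mu[OF r]
      by (intro expectation_noisy_arg_max_le[where M = "Max (mu R ` {..<m})"]) (auto simp: loss_def)
    then show ?thesis using True \<gamma> by (simp add: run_single_source)
  next
    case False
    let ?l = "lcb_arm m (1 / real n) (data acts r)"
    \<comment> \<open>The learned arm differs from \<open>a0\<close> and keeps its score. The best
      score after the rollback is thus no lower than before it, and no term in
      \<open>N a0 - k\<close> appears.\<close>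
    have "full r ?l \<le> rest r (arg_max_on (rest r) {..<m})"
      using arg_max_rest(2)[of ?l r] False lcb_arm_full(1)[of r] by (simp add: rest_eq_full)
    then have "loss (arg_max_on (rest r) {..<m}) \<le> 2 * sqrt (L / real Ns)"
      using best_full_score[OF r lcb_arm_full(1) lcb_arm_full(2)] rest_le_mu[OF r arg_max_rest(1)[of r]]
      unfolding loss_def by linarith
    then show ?thesis using False \<sigma> by (simp add: run_single_source)
  qed
  then have "expected_subopt m R acts U (single_source m (1 / real n) \<gamma> a0)
    \<le> (2 * sqrt (L / real Ns) + noise_sd \<gamma> (N a0) k) + 8 * sqrt (L / real Ns)"
    unfolding expected_subopt_def loss_def[symmetric]
    using \<sigma> w by (intro expected_loss_le set_pmf_run_single_source) auto
  then show ?thesis by (simp add: noise_sd_def)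
qed

lemma expected_rollback:
  "(\<integral>r. measure_pmf.expectation (return_pmf (arg_max_on (rest r) {..<m})) loss \<partial>rewards R acts)
    \<le> 10 * max (sqrt (L / (real (N a0) - real k))) (sqrt (L / real Ns))"
proof -
  let ?M = "max (sqrt (L / (real (N a0) - real k))) (sqrt (L / real Ns))"
  have M: "0 \<le> ?M" using L_ge by (simp add: le_max_iff_disj)
  have "(\<integral>r. measure_pmf.expectation (return_pmf (arg_max_on (rest r) {..<m})) loss \<partial>rewards R acts)
    \<le> 2 * ?M + 8 * sqrt (L / real Ns)"
    using M arg_max_rest loss_le_rest by (intro expected_loss_le) auto
  then show ?thesis by simp
qed

lemma expected_subopt_single_source_large:
  assumes "gamma0 m (1 / real n) (N a0) k \<le> \<gamma>"
  shows "expected_subopt m R acts U (single_source m (1 / real n) \<gamma> a0)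
    \<le> 10 * max (sqrt (L / (real (N a0) - real k))) (sqrt (L / real Ns))"
  using expected_rollback assms
  unfolding expected_subopt_def loss_def[symmetric] run_single_source by simp

end

section \<open>Pairs realising a given mechanism\<close>

text \<open>Arms go to \<open>score\<close>, rewards to \<open>avg\<close> and the length to
  \<open>learned\<close>, which makes the dataset recoverable. The two count vectors let the
  reference run recognise the kind of request.\<close>

definition encode :: "dataset \<Rightarrow> (nat \<Rightarrow> nat) \<Rightarrow> (nat \<Rightarrow> nat) \<Rightarrow> statistic" where
  "encode D c u =
     \<lparr>score = (\<lambda>i. real (fst (D ! i))), avg = (\<lambda>i. snd (D ! i)), counts = c, req_counts = u,
      learned = Some (length D)\<rparr>"

definition decode :: "statistic \<Rightarrow> dataset" where
  "decode T = map (\<lambda>i. (nat \<lfloor>score T i\<rfloor>, avg T i)) [0..<the (learned T)]"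

lemma decode_encode [simp]: "decode (encode D c u) = D"
  by (rule nth_equalityI) (simp_all add: encode_def decode_def)

text \<open>
  Other requests than \<open>k\<close> data points of arm \<open>a0\<close> in a dataset with \<open>n0\<close> samples of \<open>a0\<close> are
  recognised from the counts in both runs and answered by the arm \<open>0\<close>.
\<close>

definition admissible :: "nat \<Rightarrow> nat \<Rightarrow> nat \<Rightarrow> (nat \<Rightarrow> nat) \<Rightarrow> (nat \<Rightarrow> nat) \<Rightarrow> bool" where
  "admissible a0 n0 k c u \<longleftrightarrow> c a0 = n0 \<and> u = (\<lambda>a. if a = a0 then k else 0)"

definition mechanism_pair ::
  "nat \<Rightarrow> real \<Rightarrow> nat \<Rightarrow> nat \<Rightarrow> nat \<Rightarrow> (dataset \<Rightarrow> dataset \<Rightarrow> nat pmf) \<Rightarrow> (dataset \<Rightarrow> nat pmf) \<Rightarrow> pair" where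
  "mechanism_pair m \<tau> a0 n0 k P P' =
     \<lparr>learn = (\<lambda>D. return_pmf (lcb_arm m \<tau> D)),
      stat = (\<lambda>D. encode D (\<lambda>_. 0) (\<lambda>_. 0)),
      ref_stat = (\<lambda>D' c u l. encode D' c u),
      unlearn = (\<lambda>q a T. case q of
          Some V \<Rightarrow> if admissible a0 n0 k (num (decode T)) (num V) then P (decode T) V else return_pmf 0
        | None \<Rightarrow> if admissible a0 n0 k (counts T) (req_counts T) then P' (decode T) else return_pmf 0)\<rparr>"

lemma run_mechanism_pair:
  "run (mechanism_pair m \<tau> a0 n0 k P P') D U =
     (if admissible a0 n0 k (num D) (num (nths D U)) then P D (nths D U) else return_pmf 0)"
  by (simp add: run_def mechanism_pair_def bind_return_pmf)

lemma ref_run_mechanism_pair: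
  "ref_run b (mechanism_pair m \<tau> a0 n0 k P P') D U =
     (if admissible a0 n0 k (num D) (num (nths D U)) then P' (nths D (- U)) else return_pmf 0)"
  unfolding ref_run_def mechanism_pair_def
  by (simp add: bind_return_pmf) (simp add: encode_def)

text \<open>Reduces a bound on \<open>SubOpt\<close> to two laws \<open>P\<close> and
  \<open>P'\<close> that are close on admissible requests and useful on the given problems. On all
  other requests both runs answer 0, and equal laws are close since
  \<open>1 \<le> exp \<epsilon>\<close>. The output laws are functions of the data and the request,
  hence the same for both values of \<open>b\<close>.\<close>

lemma SubOpt_le_mechanism:
  fixes P :: "dataset \<Rightarrow> dataset \<Rightarrow> nat pmf" and P' :: "dataset \<Rightarrow> nat pmf"
  assumes m: "0 < m" and a0: "a0 < m" and \<epsilon>: "0 \<le> \<epsilon>" and \<delta>: "0 \<le> \<delta>"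
    and P: "\<And>D V. set_pmf (P D V) \<subseteq> {..<m}" and P': "\<And>D. set_pmf (P' D) \<subseteq> {..<m}"
    and meas: "\<And>acts U a. (\<lambda>r. pmf (P (data acts r) (nths (data acts r) U)) a)
      \<in> borel_measurable (\<Pi>\<^sub>M i\<in>{..<length acts}. (borel :: real measure))"
    and dp: "\<And>D U A. dataset m D \<Longrightarrow> admissible a0 (N a0) k (num D) (num (nths D U)) \<Longrightarrow>
      measure_pmf.prob (P D (nths D U)) A \<le> exp \<epsilon> * measure_pmf.prob (P' (nths D (- U))) A \<and>
      measure_pmf.prob (P' (nths D (- U))) A \<le> exp \<epsilon> * measure_pmf.prob (P D (nths D U)) A"
    and utility: "\<And>R acts U. (R, acts, U) \<in> problems m N Ns k a0 \<Longrightarrow>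
      (\<integral>r. measure_pmf.expectation (P (data acts r) (nths (data acts r) U))
        (\<lambda>a. Max (mu R ` {..<m}) - mu R a) \<partial>rewards R acts) \<le> x"
  shows "SubOpt b m N Ns k a0 \<epsilon> \<delta> \<le> ereal x"
proof -
  \<comment> \<open>Any learner with values among the arms would do; the confidence level 1 is an
    arbitrary choice.\<close>
  define S where "S = mechanism_pair m 1 a0 (N a0) k P P'"
  have "valid_pair m S"
    unfolding valid_pair_def
  proof (intro conjI allI impI)
    show "set_pmf (learn S D) \<subseteq> {..<m}" for D
      using arg_max_on_less(1)[OF m] by (simp add: S_def mechanism_pair_def lcb_arm_def)
    show "set_pmf (unlearn S q a T) \<subseteq> {..<m}" for q a T
      using P P' m by (simp add: S_def mechanism_pair_def split: option.split)
    show "(\<lambda>r. pmf (run S (data acts r) U) a)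
        \<in> borel_measurable (\<Pi>\<^sub>M i\<in>{..<length acts}. (borel :: real measure))" for acts U a
    proof (cases "admissible a0 (N a0) k (\<lambda>a. card (pos acts a)) (\<lambda>a. card (pos acts a \<inter> U))")
      case True
      then have "admissible a0 (N a0) k (num (data acts r)) (num (nths (data acts r) U))" for r
        by (simp add: admissible_def num_data num_nths_data fun_eq_iff)
      then show ?thesis using meas by (simp add: S_def run_mechanism_pair)
    next
      case False
      then have "\<not> admissible a0 (N a0) k (num (data acts r)) (num (nths (data acts r) U))" for r
        by (simp add: admissible_def num_data num_nths_data fun_eq_iff)
      then show ?thesis by (simp add: S_def run_mechanism_pair)
    qed
  qed
  moreover have "unlearning b m \<epsilon> \<delta> S"
    unfolding unlearning_def
  proof (intro allI impI)
    fix D U A assume D: "dataset m D" and "U \<subseteq> {..<length D}" and "A \<subseteq> {..<m}"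
    show "measure_pmf.prob (run S D U) A \<le> exp \<epsilon> * measure_pmf.prob (ref_run b S D U) A + \<delta> \<and>
        measure_pmf.prob (ref_run b S D U) A \<le> exp \<epsilon> * measure_pmf.prob (run S D U) A + \<delta>"
    proof (cases "admissible a0 (N a0) k (num D) (num (nths D U))")
      case True
      then show ?thesis
        using dp[OF D True, of A] \<delta> by (simp add: S_def run_mechanism_pair ref_run_mechanism_pair)
    next
      case False
      have "1 * measure_pmf.prob (return_pmf 0) A \<le> exp \<epsilon> * measure_pmf.prob (return_pmf 0) A"
        using \<epsilon> by (intro mult_right_mono) auto
      then show ?thesis
        using False \<delta> by (simp add: S_def run_mechanism_pair ref_run_mechanism_pair)
    qed
  qed
  ultimately have "SubOpt b m N Ns k a0 \<epsilon> \<delta> \<le> worst_subopt m N Ns k a0 S"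
    unfolding SubOpt_def by (intro INF_lower) simp
  also have "\<dots> \<le> ereal x"
    unfolding worst_subopt_def
  proof (intro SUP_least, clarify)
    fix R acts U assume p: "(R, acts, U) \<in> problems m N Ns k a0"
    then have U: "U \<subseteq> pos acts a0" "card U = k" "card (pos acts a0) = N a0"
      using a0 by (auto simp: problems_def card_pos) (auto simp: pos_def)
    then have "pos acts a0 \<inter> U = U" by auto
    moreover have "pos acts a \<inter> U = {}" if "a \<noteq> a0" for a
      using U that by (auto simp: pos_def)
    ultimately have "admissible a0 (N a0) k (num (data acts r)) (num (nths (data acts r) U))" for r
      using U by (simp add: admissible_def num_data num_nths_data fun_eq_iff)
    then show "ereal (expected_subopt m R acts U S) \<le> ereal x"
      using utility[OF p] by (simp add: expected_subopt_def S_def run_mechanism_pair)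
  qed
  finally show ?thesis .
qed

text \<open>An admissible request contains points of \<open>a0\<close> only. Since rewards lie in
  [0,1], it removes between 0 and \<open>k\<close> from the reward sum of \<open>a0\<close>; this is
  the sensitivity used for privacy.\<close>

lemma admissible_rest:
  assumes "admissible a0 n0 k (num D) (num (nths D U))"
  shows "a \<noteq> a0 \<Longrightarrow> lcb m \<tau> (nths D (- U)) a = lcb m \<tau> D a"
    and "num (nths D (- U)) a0 = n0 - k" "k \<le> n0"
    and "dataset m D \<Longrightarrow> 0 \<le> reward_sum (nths D U) a0"
    and "dataset m D \<Longrightarrow> reward_sum (nths D U) a0 \<le> real k"
proof -
  have zero: "reward_sum V a = 0" if "num V a = 0" for V a
    using that by (induction V) (auto simp: num_def reward_sum_def split: if_splits)
  have num: "num (nths D U) a = (if a = a0 then k else 0)" for a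
    using assms by (simp add: admissible_def)
  show "lcb m \<tau> (nths D (- U)) a = lcb m \<tau> D a" if "a \<noteq> a0"
    using that num_nths_compl[of D a U] reward_sum_nths_compl[of D a U] zero[of "nths D U" a] num[of a]
    by (simp add: lcb_def emp_mean_def bonus_def)
  show "num (nths D (- U)) a0 = n0 - k" "k \<le> n0"
    using num_nths_compl[of D a0 U] num[of a0] assms by (auto simp: admissible_def)
  assume D: "dataset m D"
  have "set (nths D U) \<subseteq> {..<m} \<times> {0..1}"
    using D set_nths_subset[of D U] by (auto simp: dataset_def)
  moreover have "set V \<subseteq> {..<m} \<times> {0..1} \<Longrightarrow> 0 \<le> reward_sum V a0 \<and> reward_sum V a0 \<le> real (num V a0)" for V
    by (induction V) (auto simp: num_def reward_sum_def)
  ultimately have "0 \<le> reward_sum (nths D U) a0 \<and> reward_sum (nths D U) a0 \<le> real (num (nths D U) a0)"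
    by blast
  then show "0 \<le> reward_sum (nths D U) a0" "reward_sum (nths D U) a0 \<le> real k"
    by (simp_all add: num)
qed

lemma measurable_lcb_data [measurable]:
  "(\<lambda>r. lcb m \<tau> (data acts r) a) \<in> borel_measurable (\<Pi>\<^sub>M i\<in>{..<length acts}. borel)"
  unfolding lcb_data lcb_score_def
  by (cases "pos acts a = {}")
    (auto simp: pos_def intro!: borel_measurable_diff borel_measurable_divide borel_measurable_sum measurable_component_singleton)

lemma measurable_pmf_return_pmf:
  assumes "h \<in> measurable M (count_space UNIV)"
  shows "(\<lambda>x. pmf (return_pmf (h x)) a) \<in> borel_measurable M"
  by (rule measurable_compose[OF assms]) simp

section \<open>Exact unlearning by rollback\<close>

text \<open>\<open>F\<close> rebuilds the scores on \<open>D \<setminus> U\<close> from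
  \<open>D\<close> and the removed points, and the reference run applies LCB to
  \<open>D \<setminus> U\<close>. The two laws coincide, so unlearning is exact.\<close>

lemma SubOpt_le_rollback:
  fixes N :: "nat \<Rightarrow> nat" and n :: nat
  assumes m: "2 \<le> m" and a0: "a0 < m" and Ns: "0 < Ns" and \<epsilon>: "0 \<le> \<epsilon>" and \<delta>: "0 \<le> \<delta>"
    and n: "n = (\<Sum>a<m. N a)" and k: "k < N a0"
  shows "SubOpt b m N Ns k a0 \<epsilon> \<delta>
    \<le> ereal (10 * max (sqrt (ln (real m / (1 / real n)) / (real (N a0) - real k)))
                      (sqrt (ln (real m / (1 / real n)) / real Ns)))"
proof -
  define \<Lambda> where "\<Lambda> = ln (real m / (1 / real n))"
  define F where "F D V = (lcb m (1 / real n) D)(a0 := (reward_sum D a0 - reward_sum V a0) / (real (N a0) - real k)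
      - sqrt (\<Lambda> / (2 * (real (N a0) - real k))))" for D V
  define P where "P D V = return_pmf (arg_max_on (F D V) {..<m})" for D V
  define P' where "P' D = return_pmf (lcb_arm m (1 / real n) D)" for D
  show ?thesis
  proof (rule SubOpt_le_mechanism[where P = P and P' = P'])
    show "0 < m" "a0 < m" "0 \<le> \<epsilon>" "0 \<le> \<delta>" using assms by auto
    show "set_pmf (P D V) \<subseteq> {..<m}" "set_pmf (P' D) \<subseteq> {..<m}" for D V
      using arg_max_on_less(1)[of m] m by (simp_all add: P_def P'_def lcb_arm_def)
    show "(\<lambda>r. pmf (P (data acts r) (nths (data acts r) U)) a)
        \<in> borel_measurable (\<Pi>\<^sub>M i\<in>{..<length acts}. borel)" for acts U a
      unfolding P_def
    proof (intro measurable_pmf_return_pmf measurable_arg_max_on finite_lessThan)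
      fix c
      have "(\<lambda>r. \<Sum>i\<in>I. r i) \<in> borel_measurable (\<Pi>\<^sub>M i\<in>{..<length acts}. (borel :: real measure))"
        if "I \<subseteq> pos acts a0" for I
        using that by (intro borel_measurable_sum measurable_component_singleton) (auto simp: pos_def)
      then show "(\<lambda>r. F (data acts r) (nths (data acts r) U) c)
          \<in> borel_measurable (\<Pi>\<^sub>M i\<in>{..<length acts}. borel)"
        unfolding F_def fun_upd_apply reward_sum_data reward_sum_nths_data
        by (cases "c = a0") (auto intro!: borel_measurable_diff borel_measurable_divide)
    qed
    show "measure_pmf.prob (P D (nths D U)) A \<le> exp \<epsilon> * measure_pmf.prob (P' (nths D (- U))) A \<and>
      measure_pmf.prob (P' (nths D (- U))) A \<le> exp \<epsilon> * measure_pmf.prob (P D (nths D U)) A"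
      if D: "dataset m D" "admissible a0 (N a0) k (num D) (num (nths D U))" for D U A
    proof -
      have "F D (nths D U) a = lcb m (1 / real n) (nths D (- U)) a" for a
        using admissible_rest[OF D(2)] reward_sum_nths_compl[of D a0 U] k
        by (auto simp: F_def \<Lambda>_def lcb_def emp_mean_def bonus_def of_nat_diff)
      then have "F D (nths D U) = lcb m (1 / real n) (nths D (- U))" by (rule ext)
      then have eq: "P D (nths D U) = P' (nths D (- U))"
        by (simp add: P_def P'_def lcb_arm_def)
      have "1 * measure_pmf.prob (P D (nths D U)) A \<le> exp \<epsilon> * measure_pmf.prob (P D (nths D U)) A"
        using \<epsilon> by (intro mult_right_mono) auto
      then show ?thesis by (simp add: eq)
    qed
    fix R acts U assume p: "(R, acts, U) \<in> problems m N Ns k a0"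
    interpret bandit_problem m N Ns k a0 n R acts U
      by unfold_locales (use assms p in auto)
    have "F (data acts r) (nths (data acts r) U) = rest r" for r
      by (rule ext) (simp add: F_def rest_a0 rest_eq_full lcb_eq_full L_def \<Lambda>_def)
    then show "(\<integral>r. measure_pmf.expectation (P (data acts r) (nths (data acts r) U))
        (\<lambda>a. Max (mu R ` {..<m}) - mu R a) \<partial>rewards R acts)
      \<le> 10 * max (sqrt (ln (real m / (1 / real n)) / (real (N a0) - real k)))
                 (sqrt (ln (real m / (1 / real n)) / real Ns))"
      using expected_rollback
      unfolding P_def loss_def[symmetric] L_def by simp
  qed
qed

section \<open>Randomised choice between one arm and its best competitor\<close>

definition logistic :: "real \<Rightarrow> real" where
  "logistic x = 1 / (1 + exp (- x))"

lemma logistic_bounds: "0 \<le> logistic x" "logistic x \<le> 1"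
  using exp_gt_zero[of "- x"] by (auto simp: logistic_def divide_le_eq add_pos_pos less_imp_le)

lemma logistic_minus: "1 - logistic x = logistic (- x)"
proof -
  have "1 + exp x \<noteq> 0" "1 + exp (- x) \<noteq> 0"
    using exp_gt_zero[of x] exp_gt_zero[of "- x"] by linarith+
  then show ?thesis
    by (simp add: logistic_def exp_minus field_simps)
qed

text \<open>Compare \<open>1 + exp (- y)\<close> with
  \<open>exp \<epsilon> * (1 + exp (- x))\<close> term by term.\<close>

lemma logistic_le:
  assumes "x \<le> y + \<epsilon>" "0 \<le> \<epsilon>"
  shows "logistic x \<le> exp \<epsilon> * logistic y"
proof -
  have "1 + exp (- y) \<le> exp \<epsilon> * (1 + exp (- x))"
  proof -
    have "exp (- y) \<le> exp \<epsilon> * exp (- x)"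
      using assms by (simp add: exp_add[symmetric])
    moreover have "1 \<le> exp \<epsilon>" using assms by simp
    ultimately show ?thesis unfolding distrib_left by linarith
  qed
  then show ?thesis
    using exp_gt_zero[of "- x"] exp_gt_zero[of "- y"]
    by (simp add: logistic_def field_simps add_pos_pos)
qed

text \<open>With \<open>u = t * x\<close> this is \<open>u \<le> 1 + exp u\<close> divided by
  \<open>t * (1 + exp u)\<close>.\<close>

lemma mult_logistic_le:
  assumes t: "0 < t" and x: "0 \<le> x"
  shows "x * logistic (- (t * x)) \<le> 1 / t"
proof -
  have "t * x \<le> 1 + exp (t * x)" using exp_ge_add_one_self[of "t * x"] by linarith
  then show ?thesis
    using t exp_gt_zero[of "t * x"] by (simp add: logistic_def field_simps add_pos_pos)
qed

definition competitor :: "nat \<Rightarrow> nat \<Rightarrow> (nat \<Rightarrow> real) \<Rightarrow> nat" where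
  "competitor m a0 F = arg_max_on F ({..<m} - {a0})"

text \<open>The exponential mechanism on two candidates: \<open>a0\<close> and its competitor have
  weights \<open>exp (t * score)\<close>. With only two candidates the expected cost does not grow
  with the number of arms.\<close>

definition choose_arm :: "nat \<Rightarrow> nat \<Rightarrow> real \<Rightarrow> (nat \<Rightarrow> real) \<Rightarrow> nat pmf" where
  "choose_arm m a0 t F =
     map_pmf (\<lambda>c. if c then a0 else competitor m a0 F)
       (bernoulli_pmf (logistic (t * (F a0 - F (competitor m a0 F)))))"

lemma expectation_choose_arm:
  fixes g :: "nat \<Rightarrow> real"
  shows "measure_pmf.expectation (choose_arm m a0 t F) g =
    logistic (t * (F a0 - F (competitor m a0 F))) * g a0 +
    logistic (t * (F (competitor m a0 F) - F a0)) * g (competitor m a0 F)"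
proof -
  have "logistic (t * (F (competitor m a0 F) - F a0)) = 1 - logistic (t * (F a0 - F (competitor m a0 F)))"
    by (simp add: logistic_minus right_diff_distrib)
  then show ?thesis
    using logistic_bounds by (simp add: choose_arm_def)
qed

lemma prob_choose_arm:
  "measure_pmf.prob (choose_arm m a0 t F) A =
    logistic (t * (F a0 - F (competitor m a0 F))) * indicator A a0 +
    logistic (t * (F (competitor m a0 F) - F a0)) * indicator A (competitor m a0 F)"
  using expectation_choose_arm[of m a0 t F "indicator A"] by simp

lemma competitor_mem:
  assumes "2 \<le> m"
  shows "competitor m a0 F < m" "competitor m a0 F \<noteq> a0"
    "\<And>c. c < m \<Longrightarrow> c \<noteq> a0 \<Longrightarrow> F c \<le> F (competitor m a0 F)"
proof -
  have "(if a0 = 0 then 1 else 0) \<in> {..<m} - {a0}" using assms by auto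
  then have "{..<m} - {a0} \<noteq> {}" by blast
  from arg_max_on_mem_ge[OF _ this, where f = F]
  show "competitor m a0 F < m" "competitor m a0 F \<noteq> a0"
    "\<And>c. c < m \<Longrightarrow> c \<noteq> a0 \<Longrightarrow> F c \<le> F (competitor m a0 F)"
    by (auto simp: competitor_def)
qed

lemma competitor_cong:
  "(\<And>a. a \<noteq> a0 \<Longrightarrow> F a = G a) \<Longrightarrow> competitor m a0 F = competitor m a0 G"
  unfolding competitor_def by (rule arg_max_on_cong) auto

text \<open>The competitor is determined by scores that agree in \<open>F\<close> and
  \<open>G\<close>, so both laws live on the same two arms. The logistic arguments differ by at most
  \<open>\<epsilon>\<close>, hence each of the two probabilities changes by a factor of at most
  \<open>exp \<epsilon>\<close>.\<close>

lemma choose_arm_private: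
  assumes m: "2 \<le> m" and t: "0 \<le> t" and \<epsilon>: "t * \<bar>F a0 - G a0\<bar> \<le> \<epsilon>"
    and eq: "\<And>a. a \<noteq> a0 \<Longrightarrow> F a = G a"
  shows "measure_pmf.prob (choose_arm m a0 t F) A \<le> exp \<epsilon> * measure_pmf.prob (choose_arm m a0 t G) A"
proof -
  let ?b = "competitor m a0 F"
  have b: "competitor m a0 G = ?b" "F ?b = G ?b"
    using competitor_cong[OF eq, where m = m] eq competitor_mem(2)[OF m] by auto
  have \<epsilon>': "\<bar>t * F a0 - t * G a0\<bar> \<le> \<epsilon>"
    using \<epsilon> t by (simp add: right_diff_distrib[symmetric] abs_mult)
  then have "logistic (t * (F a0 - F ?b)) \<le> exp \<epsilon> * logistic (t * (G a0 - G ?b))"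
    "logistic (t * (F ?b - F a0)) \<le> exp \<epsilon> * logistic (t * (G ?b - G a0))"
    by (auto intro!: logistic_le simp: b right_diff_distrib)
  from add_mono[OF mult_right_mono[OF this(1), of "indicator A a0"]
      mult_right_mono[OF this(2), of "indicator A ?b"]]
  show ?thesis
    unfolding prob_choose_arm b(1) by (simp add: algebra_simps)
qed

text \<open>The arm with the smaller score is chosen with a probability exponentially small in \<open>t\<close> times
  the gap, so it costs at most \<open>1 / t\<close> on average.\<close>

lemma expectation_choose_arm_le:
  fixes F g :: "nat \<Rightarrow> real"
  assumes m: "2 \<le> m" and a0: "a0 < m" and t: "0 < t"
    and g: "\<And>a. a < m \<Longrightarrow> g a \<le> M - F a"
    and \<beta>: "\<And>b. b < m \<Longrightarrow> (\<And>c. c < m \<Longrightarrow> F c \<le> F b) \<Longrightarrow> M - F b \<le> \<beta>"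
  shows "measure_pmf.expectation (choose_arm m a0 t F) g \<le> \<beta> + 1 / t"
proof -
  define b where "b = competitor m a0 F"
  note b = competitor_mem[OF m, where F = F and ?a0.0 = a0, folded b_def]
  define p where "p = logistic (t * (F a0 - F b))"
  define q where "q = logistic (t * (F b - F a0))"
  have pq: "0 \<le> p" "0 \<le> q" "q = 1 - p"
    using logistic_bounds logistic_minus[of "t * (F a0 - F b)"]
    by (auto simp: p_def q_def algebra_simps)
  have "measure_pmf.expectation (choose_arm m a0 t F) g = p * g a0 + q * g b"
    by (simp add: expectation_choose_arm p_def q_def b_def)
  also have "\<dots> \<le> p * (M - F a0) + q * (M - F b)"
    using pq g a0 b by (intro add_mono mult_left_mono) auto
  also have "\<dots> \<le> \<beta> + 1 / t"
  proof (cases "F b \<le> F a0")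
    case True
    have "F c \<le> F a0" if "c < m" for c
      using True b(3)[OF that] by (cases "c = a0") auto
    then have "M - F a0 \<le> \<beta>" using \<beta>[OF a0] by simp
    moreover have "(F a0 - F b) * q \<le> 1 / t"
      using mult_logistic_le[OF t, of "F a0 - F b"] True by (simp add: q_def algebra_simps)
    moreover have "p * (M - F a0) + q * (M - F b) = (M - F a0) + (F a0 - F b) * q"
      unfolding pq(3) by (simp add: algebra_simps)
    ultimately show ?thesis by linarith
  next
    case False
    have "F c \<le> F b" if "c < m" for c
      using False b(3)[OF that] by (cases "c = a0") auto
    then have "M - F b \<le> \<beta>" using \<beta>[OF b(1)] by simp
    moreover have "(F b - F a0) * p \<le> 1 / t"
      using mult_logistic_le[OF t, of "F b - F a0"] False by (simp add: p_def algebra_simps)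
    moreover have "p * (M - F a0) + q * (M - F b) = (M - F b) + (F b - F a0) * p"
      unfolding pq(3) by (simp add: algebra_simps)
    ultimately show ?thesis by linarith
  qed
  finally show ?thesis .
qed

lemma SubOpt_le_choose_arm:
  fixes N :: "nat \<Rightarrow> nat" and n :: nat
  assumes m: "2 \<le> m" and a0: "a0 < m" and Ns: "0 < Ns" and \<epsilon>: "0 < \<epsilon>" and \<delta>: "0 \<le> \<delta>"
    and n: "n = (\<Sum>a<m. N a)" and k: "k < N a0" "0 < k"
  shows "SubOpt b m N Ns k a0 \<epsilon> \<delta>
    \<le> ereal (10 * sqrt (ln (real m / (1 / real n)) / real Ns) + real k / (real (N a0) * \<epsilon>))"
proof -
  define \<Lambda> where "\<Lambda> = ln (real m / (1 / real n))"
  \<comment> \<open>The privacy parameter \<open>\<epsilon>\<close> divided by the sensitivity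
    \<open>k / N a0\<close> of the score of \<open>a0\<close>; then \<open>1 / t\<close> is the cost
    in the claim.\<close>
  define t where "t = \<epsilon> * real (N a0) / real k"
  have t: "0 < t" using \<epsilon> k by (simp add: t_def)
  define P where "P D V = choose_arm m a0 t (lcb m (1 / real n) D)" for D and V :: dataset
  \<comment> \<open>The reference score divides the remaining rewards by the count before removal
    and keeps the old bonus. It therefore differs from the score on \<open>D\<close> only by the
    removed rewards over \<open>N a0\<close>, which is at most \<open>k / N a0\<close>.\<close>
  define G where "G D = (lcb m (1 / real n) D)
      (a0 := reward_sum D a0 / real (N a0) - sqrt (\<Lambda> / (2 * real (N a0))))" for D
  define P' where "P' D = choose_arm m a0 t (G D)" for D
  have set: "set_pmf (choose_arm m a0 t F) \<subseteq> {..<m}" for F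
    using a0 competitor_mem(1)[OF m] by (auto simp: choose_arm_def)
  show ?thesis
  proof (rule SubOpt_le_mechanism[where P = P and P' = P'])
    show "0 < m" "a0 < m" "0 \<le> \<epsilon>" "0 \<le> \<delta>" using assms by auto
    show "set_pmf (P D V) \<subseteq> {..<m}" "set_pmf (P' D) \<subseteq> {..<m}" for D V
      using set by (simp_all add: P_def P'_def)
    show "(\<lambda>r. pmf (P (data acts r) (nths (data acts r) U)) a)
        \<in> borel_measurable (\<Pi>\<^sub>M i\<in>{..<length acts}. borel)" for acts U a
    proof -
      let ?M = "\<Pi>\<^sub>M i\<in>{..<length acts}. borel :: real measure"
      let ?F = "\<lambda>r. lcb m (1 / real n) (data acts r)"
      have b [measurable]: "(\<lambda>r. competitor m a0 (?F r)) \<in> measurable ?M (count_space UNIV)"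
        unfolding competitor_def by (rule measurable_arg_max_on) auto
      \<comment> \<open>The arm whose score is read is itself random; it has countably many values,
        which keeps the composition measurable.\<close>
      have [measurable]: "(\<lambda>r. ?F r (competitor m a0 (?F r))) \<in> borel_measurable ?M"
        by (rule measurable_compose_countable[OF _ b]) simp
      have [measurable]: "(\<lambda>r. indicator {a} (competitor m a0 (?F r)) :: real) \<in> borel_measurable ?M"
        by (rule measurable_compose[OF b]) simp
      show ?thesis
        unfolding P_def measure_pmf_single[symmetric] prob_choose_arm logistic_def by measurable
    qed
    show "measure_pmf.prob (P D (nths D U)) A \<le> exp \<epsilon> * measure_pmf.prob (P' (nths D (- U))) A \<and>
      measure_pmf.prob (P' (nths D (- U))) A \<le> exp \<epsilon> * measure_pmf.prob (P D (nths D U)) A"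
      if D: "dataset m D" "admissible a0 (N a0) k (num D) (num (nths D U))" for D U A
    proof -
      let ?F = "lcb m (1 / real n) D" and ?G = "G (nths D (- U))"
      have eq: "?F a = ?G a" if "a \<noteq> a0" for a
        using admissible_rest(1)[OF D(2) that] that by (simp add: G_def)
      have "num D a0 = N a0" using D(2) by (simp add: admissible_def)
      then have "?F a0 - ?G a0 = reward_sum (nths D U) a0 / real (N a0)"
        using k reward_sum_nths_compl[of D a0 U]
        by (simp add: G_def \<Lambda>_def lcb_def emp_mean_def bonus_def add_divide_distrib)
      then have "\<bar>?F a0 - ?G a0\<bar> \<le> real k / real (N a0)"
        using admissible_rest(4,5)[OF D(2,1)] by (simp add: abs_of_nonneg divide_right_mono)
      then have "t * \<bar>?F a0 - ?G a0\<bar> \<le> t * (real k / real (N a0))"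
        using t by (intro mult_left_mono) auto
      also have "\<dots> = \<epsilon>" using k by (simp add: t_def)
      finally have \<epsilon>: "t * \<bar>?F a0 - ?G a0\<bar> \<le> \<epsilon>" .
      show ?thesis
        unfolding P_def P'_def using t \<epsilon> eq
        by (intro conjI choose_arm_private[OF m]) (auto simp: abs_minus_commute)
    qed
    fix R acts U assume p: "(R, acts, U) \<in> problems m N Ns k a0"
    interpret bandit_problem m N Ns k a0 n R acts U
      by unfold_locales (use assms p in auto)
    have w: "0 \<le> sqrt (L / real Ns)" using L_ge by simp
    have "(\<integral>r. measure_pmf.expectation (P (data acts r) (nths (data acts r) U)) loss \<partial>rewards R acts)
      \<le> (2 * sqrt (L / real Ns) + 1 / t) + 8 * sqrt (L / real Ns)"
    proof (rule expected_loss_le)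
      show "set_pmf (P (data acts r) (nths (data acts r) U)) \<subseteq> {..<m}" for r
        using set by (simp add: P_def)
      show "0 \<le> 2 * sqrt (L / real Ns) + 1 / t" using w t by simp
      fix r assume r: "good_event r"
      show "measure_pmf.expectation (P (data acts r) (nths (data acts r) U)) loss
        \<le> 2 * sqrt (L / real Ns) + 1 / t"
        unfolding P_def lcb_eq_full
        by (rule expectation_choose_arm_le[OF m a0 t, where M = "Max (mu R ` {..<m})"])
          (use full_le_mu[OF r] best_full_score[OF r] in \<open>auto simp: loss_def\<close>)
    qed
    then show "(\<integral>r. measure_pmf.expectation (P (data acts r) (nths (data acts r) U))
        (\<lambda>a. Max (mu R ` {..<m}) - mu R a) \<partial>rewards R acts)
      \<le> 10 * sqrt (ln (real m / (1 / real n)) / real Ns) + real k / (real (N a0) * \<epsilon>)"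
      unfolding loss_def[symmetric] L_def
      by (simp add: t_def mult.commute)
  qed
qed

section \<open>Collecting the constants\<close>

lemma add_le_12_max:
  fixes x y w :: real
  assumes "0 \<le> x" "0 \<le> y" "c \<le> 2"
  shows "10 * w + c * y \<le> 12 * max (x + y) w"
proof -
  have "c * y \<le> 2 * y" using assms by (intro mult_right_mono)
  then show ?thesis using assms by (simp add: max_def)
qed

theorem theorem3p3:
  shows "\<exists>C>0. \<forall>(m::nat) (N :: nat \<Rightarrow> nat) (Ns::nat) (k::nat) (a0::nat) (\<epsilon>::real) (\<delta>::real)
      (n::nat) (\<tau>::real) (\<gamma>::real).
    2 \<le> m \<longrightarrow> a0 < m \<longrightarrow> 0 < N a0 \<longrightarrow> 0 < Ns \<longrightarrow> 0 < \<epsilon> \<longrightarrow> 0 < \<delta> \<longrightarrow> \<delta> \<le> 1 \<longrightarrow>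
    n = (\<Sum>a<m. N a) \<longrightarrow> \<tau> = 1 / real n \<longrightarrow> \<gamma> = sqrt (2 * ln (1.25 / \<delta>)) / \<epsilon> \<longrightarrow>
    real k \<le> real (N a0) - sqrt (real (N a0) * ln (real m / \<tau>) / 2) \<longrightarrow>
    (let \<gamma>0 = 4 / 3 * sqrt (pi * ln (real n * real m) / (real (N a0) - real k));
         small = C * max (sqrt (ln (real n * real m) / real (N a0)) + real k * \<gamma> / real (N a0))
                         (sqrt (ln (real n * real m) / real Ns));
         large = C * max (sqrt (ln (real n * real m) / (real (N a0) - real k)))
                         (sqrt (ln (real n * real m) / real Ns))
     in (\<gamma> < \<gamma>0 \<longrightarrow>
           worst_subopt m N Ns k a0 (single_source m \<tau> \<gamma> a0) \<le> ereal small \<and>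
           (\<forall>b. SubOpt b m N Ns k a0 \<epsilon> \<delta> \<le> ereal small)) \<and>
        (\<gamma>0 \<le> \<gamma> \<longrightarrow>
           worst_subopt m N Ns k a0 (single_source m \<tau> \<gamma> a0) \<le> ereal large \<and>
           (\<forall>b. SubOpt b m N Ns k a0 \<epsilon> \<delta> \<le> ereal large)))"
\<comment> \<open>12 = 2 + 8 + 2: twice the bonus on the good event, the failure probability, and at
  most 2 for the randomisation (3/2 from the Gaussian deviation, 2 from
  \<open>1 / \<epsilon> \<le> 2 * \<gamma>\<close>).\<close>
proof (rule exI[of _ 12], intro conjI allI impI, goal_cases)
  case 1
  show ?case by simp
next
  case (2 m N Ns k a0 \<epsilon> \<delta> n \<tau> \<gamma>)
  note m = \<open>2 \<le> m\<close> and a0 = \<open>a0 < m\<close> and Ns = \<open>0 < Ns\<close> and \<epsilon> = \<open>0 < \<epsilon>\<close> and \<delta> = \<open>0 < \<delta>\<close> \<open>\<delta> \<le> 1\<close>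
    and n = \<open>n = (\<Sum>a<m. N a)\<close> and \<tau> = \<open>\<tau> = 1 / real n\<close> and \<gamma> = \<open>\<gamma> = sqrt (2 * ln (1.25 / \<delta>)) / \<epsilon>\<close>
  define \<Lambda> where "\<Lambda> = ln (real n * real m)"
  have \<Lambda>: "ln (real m / \<tau>) = \<Lambda>" "ln (real m / (1 / real n)) = \<Lambda>"
    by (simp_all add: \<Lambda>_def \<tau> mult.commute)
  have "N a0 \<le> n" unfolding n using a0 by (intro member_le_sum) auto
  with \<open>0 < N a0\<close> have n_pos: "0 < n" by simp
  have "1 * 2 \<le> real n * real m" using m n_pos by (intro mult_mono) auto
  then have \<Lambda>_pos: "0 < \<Lambda>" by (simp add: \<Lambda>_def)
  have "0 < sqrt (real (N a0) * \<Lambda> / 2)" using \<open>0 < N a0\<close> \<Lambda>_pos by simp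
  \<comment> \<open>As \<open>\<Lambda>\<close> is positive, the condition on \<open>k\<close>
    leaves at least one sample of \<open>a0\<close> in \<open>D \<setminus> U\<close>.\<close>
  then have "real k < real (N a0)" using 2(11) unfolding \<Lambda> by linarith
  then have k: "k < N a0" by simp
  \<comment> \<open>By \<open>\<delta> \<le> 1\<close> the numerator of \<open>\<gamma>\<close> is
    at least \<open>sqrt (2 / 5) \<ge> 1 / 2\<close>. This turns the logistic cost
    \<open>k / (N a0 * \<epsilon>)\<close> into a multiple of
    \<open>k * \<gamma> / N a0\<close>.\<close>
  have ln_ge: "1 / 5 \<le> ln (1.25 / \<delta>)"
  proof -
    have "1 - y / x \<le> ln (x / y)" if "0 < x" "0 < y" for x y :: real
      using ln_le_minus_one[of "y / x"] that by (simp add: ln_divide_pos)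
    from this[of "1.25" \<delta>] have "1 - \<delta> / 1.25 \<le> ln (1.25 / \<delta>)" using \<delta> by simp
    then show ?thesis using \<delta> by simp
  qed
  have "1 / 2 \<le> sqrt (2 * ln (1.25 / \<delta>))"
    using ln_ge by (intro real_le_rsqrt) (simp add: power2_eq_square)
  then have \<gamma>_ge: "1 / \<epsilon> \<le> 2 * \<gamma>" using \<epsilon> by (simp add: \<gamma> field_simps)
  moreover have "0 < 1 / \<epsilon>" using \<epsilon> by simp
  ultimately have \<gamma>_pos: "0 < \<gamma>" by linarith
  have g0: "gamma0 m (1 / real n) (N a0) k = 4 / 3 * sqrt (pi * \<Lambda> / (real (N a0) - real k))"
    unfolding gamma0_def \<Lambda> ..
  let ?w = "sqrt (\<Lambda> / real Ns)" and ?x = "sqrt (\<Lambda> / real (N a0))" and ?y = "real k * \<gamma> / real (N a0)"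
    and ?z = "sqrt (\<Lambda> / (real (N a0) - real k))"
  have pos: "0 \<le> ?w" "0 \<le> ?x" "0 \<le> ?y" "0 \<le> ?z"
    using \<Lambda>_pos \<gamma>_pos k by auto
  have bandit: "bandit_problem m N Ns k a0 n R acts U" if "(R, acts, U) \<in> problems m N Ns k a0" for R acts U
    using that m a0 Ns n k by unfold_locales auto
  have single_small: "worst_subopt m N Ns k a0 (single_source m \<tau> \<gamma> a0) \<le> ereal (12 * max (?x + ?y) ?w)"
    if "\<gamma> < gamma0 m (1 / real n) (N a0) k"
    unfolding worst_subopt_def
  proof (intro SUP_least, clarify)
    fix R acts U assume "(R, acts, U) \<in> problems m N Ns k a0"
    then interpret bandit_problem m N Ns k a0 n R acts U by (rule bandit)
    have "expected_subopt m R acts U (single_source m \<tau> \<gamma> a0) \<le> 10 * ?w + 3 / 2 * ?y"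
      using expected_subopt_single_source_small[OF less_imp_le[OF \<gamma>_pos] that] unfolding L_def \<Lambda> \<tau> .
    also have "\<dots> \<le> 12 * max (?x + ?y) ?w" using pos by (intro add_le_12_max) auto
    finally show "ereal (expected_subopt m R acts U (single_source m \<tau> \<gamma> a0)) \<le> ereal (12 * max (?x + ?y) ?w)"
      by simp
  qed
  have single_large: "worst_subopt m N Ns k a0 (single_source m \<tau> \<gamma> a0) \<le> ereal (12 * max ?z ?w)"
    if "gamma0 m (1 / real n) (N a0) k \<le> \<gamma>"
    unfolding worst_subopt_def
  proof (intro SUP_least, clarify)
    fix R acts U assume "(R, acts, U) \<in> problems m N Ns k a0"
    then interpret bandit_problem m N Ns k a0 n R acts U by (rule bandit)
    have "expected_subopt m R acts U (single_source m \<tau> \<gamma> a0) \<le> 10 * max ?z ?w"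
      using expected_subopt_single_source_large[OF that] unfolding L_def \<Lambda> \<tau> .
    also have "\<dots> \<le> 12 * max ?z ?w" using pos by linarith
    finally show "ereal (expected_subopt m R acts U (single_source m \<tau> \<gamma> a0)) \<le> ereal (12 * max ?z ?w)"
      by simp
  qed
  have large: "SubOpt b m N Ns k a0 \<epsilon> \<delta> \<le> ereal (12 * max ?z ?w)" for b
  proof -
    have "SubOpt b m N Ns k a0 \<epsilon> \<delta> \<le> ereal (10 * max ?z ?w)"
      using SubOpt_le_rollback[OF m a0 Ns _ _ n k, of \<epsilon> \<delta> b] \<epsilon> \<delta> unfolding \<Lambda> by simp
    also have "\<dots> \<le> ereal (12 * max ?z ?w)" using pos by (simp add: le_max_iff_disj)
    finally show ?thesis .
  qed
  have small: "SubOpt b m N Ns k a0 \<epsilon> \<delta> \<le> ereal (12 * max (?x + ?y) ?w)" for b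
  proof (cases "k = 0")
    \<comment> \<open>For \<open>k = 0\<close> the scale \<open>t\<close> is undefined, but then the
      rollback bound is literally the required one: \<open>N a0 - k\<close> is \<open>N a0\<close>
      and the \<open>\<gamma>\<close> term vanishes.\<close>
    case True
    then show ?thesis using large[of b] by simp
  next
    case False
    then have "SubOpt b m N Ns k a0 \<epsilon> \<delta> \<le> ereal (10 * ?w + real k / (real (N a0) * \<epsilon>))"
      using SubOpt_le_choose_arm[OF m a0 Ns \<epsilon> _ n k, of \<delta> b] \<delta> unfolding \<Lambda> by simp
    also have "10 * ?w + real k / (real (N a0) * \<epsilon>) \<le> 10 * ?w + 2 * ?y"
      using mult_left_mono[OF \<gamma>_ge, of "real k / real (N a0)"] by (simp add: mult.left_commute)
    also have "\<dots> \<le> 12 * max (?x + ?y) ?w" using pos by (intro add_le_12_max) auto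
    finally show ?thesis by simp
  qed
  show ?case
    unfolding Let_def \<Lambda>_def[symmetric] g0[symmetric]
    using single_small single_large large small by blast
qed

end
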